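(* Let $\mathbb{K}$ be a field, $Q$ a quiver, and $H$ a set of paths of $Q$ that is closed under taking subpaths and such that for every two vertices $v,w$ in $H$ there are only finitely many paths in $H$ that start at $v$ and end at $w$. Let $C$ be the monomial coalgebra with basis $H$ (a subcoalgebra of the path coalgebra $\mathbb{K}Q$). Then $C$ is directly coreflexive, the rational left $C^*$-modules are closed under extensions in the category of all left $C^*$-modules, and the rational right $C^*$-modules are closed under extensions in the category of all right $C^*$-modules.
   Context: A quiver is an oriented graph, possibly infinite, with loops, cycles and (possibly infinitely many) multiple arrows allowed. The path coalgebra $\mathbb{K}Q$ has as basis the set of oriented paths in $Q$ (vertices being paths of length $0$), comultiplication $\Delta(r)=\sum_{r=pq}p\otimes q$ (sum over factorizations of $r$ as the path $p$ followed by the path $q$) and counit $\varepsilon(p)=\delta_{0,|p|}$, where $|p|$ is the length of $p$. If $H$ is a set of paths closed under taking subpaths (including the vertices on them), the span of $H$ is a subcoalgebra of $\mathbb{K}Q$, called the monomial coalgebra (path subcoalgebra) with basis $H$. For a $\mathbb{K}$-coalgebra $C$, the dual $C^*$ is an algebra under convolution. A right $C$-comodule $M$ with coaction $m\mapsto \sum m_0\otimes m_1$ is a left $C^*$-module via $c^*\cdot m=\sum c^*(m_1)m_0$; the left $C^*$-modules arising this way are called rational, and rational right $C^*$-modules are defined similarly from left $C$-comodules. $C$ is directly coreflexive if the class of finite dimensional rational left $C^*$-modules is closed under extensions in the category of all left $C^*$-modules (this is equivalent to the same condition on the right). *)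

theory Defs
  imports "HOL-Library.Poly_Mapping" "Graph_Theory.Arc_Walk"
begin

section \<open>Free vector spaces and tensor products\<close>

text \<open>
  The type \<^typ>\<open>'a \<Rightarrow>\<^sub>0 'k\<close> of finitely supported functions is the vector space with basis \<open>'a\<close>.
\<close>

definition fscale :: "'k::field \<Rightarrow> ('a \<Rightarrow>\<^sub>0 'k) \<Rightarrow> ('a \<Rightarrow>\<^sub>0 'k)" where
  "fscale k x = Poly_Mapping.map ((*) k) x"

abbreviation fbasis :: "'a \<Rightarrow> ('a \<Rightarrow>\<^sub>0 'k::field)" where
  "fbasis a \<equiv> Poly_Mapping.single a 1"

text \<open>Linear extension of a map given on the basis \<open>'a\<close>.\<close>

definition flin :: "('k::field \<Rightarrow> 'm::ab_group_add \<Rightarrow> 'm) \<Rightarrow> ('a \<Rightarrow> 'm) \<Rightarrow> ('a \<Rightarrow>\<^sub>0 'k) \<Rightarrow> 'm" where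
  "flin s g x = (\<Sum>a\<in>Poly_Mapping.keys x. s (Poly_Mapping.lookup x a) (g a))"

text \<open>
  For subspaces \<open>A\<close>, \<open>B\<close> of vector spaces, the tensor product of \<open>A\<close> and \<open>B\<close> is the quotient of the
  free vector space on \<open>A \<times> B\<close> by the span of the bilinearity relations. Its elements are
  represented by formal sums (elements of the free vector space) whose support lies in \<open>A \<times> B\<close>, and
  equality in the tensor product is the relation \<open>tensor_eq\<close> on formal sums. The threefold tensor
  product is treated in the same way, with trilinearity relations on \<open>A \<times> B \<times> D\<close>.
\<close>

definition tensor_rels ::
  "('k::field \<Rightarrow> 'a::ab_group_add \<Rightarrow> 'a) \<Rightarrow> 'a set \<Rightarrow> ('k \<Rightarrow> 'b::ab_group_add \<Rightarrow> 'b) \<Rightarrow> 'b set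
    \<Rightarrow> ('a \<times> 'b \<Rightarrow>\<^sub>0 'k) set" where
  "tensor_rels sA A sB B =
     {fbasis (a + a', b) - fbasis (a, b) - fbasis (a', b) | a a' b. a \<in> A \<and> a' \<in> A \<and> b \<in> B}
   \<union> {fbasis (a, b + b') - fbasis (a, b) - fbasis (a, b') | a b b'. a \<in> A \<and> b \<in> B \<and> b' \<in> B}
   \<union> {fbasis (sA k a, b) - fscale k (fbasis (a, b)) | k a b. a \<in> A \<and> b \<in> B}
   \<union> {fbasis (a, sB k b) - fscale k (fbasis (a, b)) | k a b. a \<in> A \<and> b \<in> B}"

definition tensor_eq ::
  "('k::field \<Rightarrow> 'a::ab_group_add \<Rightarrow> 'a) \<Rightarrow> 'a set \<Rightarrow> ('k \<Rightarrow> 'b::ab_group_add \<Rightarrow> 'b) \<Rightarrow> 'b set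
    \<Rightarrow> ('a \<times> 'b \<Rightarrow>\<^sub>0 'k) \<Rightarrow> ('a \<times> 'b \<Rightarrow>\<^sub>0 'k) \<Rightarrow> bool" where
  "tensor_eq sA A sB B t u \<longleftrightarrow> t - u \<in> module.span fscale (tensor_rels sA A sB B)"

definition tensor3_rels ::
  "('k::field \<Rightarrow> 'a::ab_group_add \<Rightarrow> 'a) \<Rightarrow> 'a set \<Rightarrow> ('k \<Rightarrow> 'b::ab_group_add \<Rightarrow> 'b) \<Rightarrow> 'b set
    \<Rightarrow> ('k \<Rightarrow> 'd::ab_group_add \<Rightarrow> 'd) \<Rightarrow> 'd set \<Rightarrow> ('a \<times> 'b \<times> 'd \<Rightarrow>\<^sub>0 'k) set" where
  "tensor3_rels sA A sB B sD D =
     {fbasis (a + a', b, d) - fbasis (a, b, d) - fbasis (a', b, d) | a a' b d.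
        a \<in> A \<and> a' \<in> A \<and> b \<in> B \<and> d \<in> D}
   \<union> {fbasis (a, b + b', d) - fbasis (a, b, d) - fbasis (a, b', d) | a b b' d.
        a \<in> A \<and> b \<in> B \<and> b' \<in> B \<and> d \<in> D}
   \<union> {fbasis (a, b, d + d') - fbasis (a, b, d) - fbasis (a, b, d') | a b d d'.
        a \<in> A \<and> b \<in> B \<and> d \<in> D \<and> d' \<in> D}
   \<union> {fbasis (sA k a, b, d) - fscale k (fbasis (a, b, d)) | k a b d. a \<in> A \<and> b \<in> B \<and> d \<in> D}
   \<union> {fbasis (a, sB k b, d) - fscale k (fbasis (a, b, d)) | k a b d. a \<in> A \<and> b \<in> B \<and> d \<in> D}
   \<union> {fbasis (a, b, sD k d) - fscale k (fbasis (a, b, d)) | k a b d. a \<in> A \<and> b \<in> B \<and> d \<in> D}"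

definition tensor3_eq ::
  "('k::field \<Rightarrow> 'a::ab_group_add \<Rightarrow> 'a) \<Rightarrow> 'a set \<Rightarrow> ('k \<Rightarrow> 'b::ab_group_add \<Rightarrow> 'b) \<Rightarrow> 'b set
    \<Rightarrow> ('k \<Rightarrow> 'd::ab_group_add \<Rightarrow> 'd) \<Rightarrow> 'd set
    \<Rightarrow> ('a \<times> 'b \<times> 'd \<Rightarrow>\<^sub>0 'k) \<Rightarrow> ('a \<times> 'b \<times> 'd \<Rightarrow>\<^sub>0 'k) \<Rightarrow> bool" where
  "tensor3_eq sA A sB B sD D t u \<longleftrightarrow> t - u \<in> module.span fscale (tensor3_rels sA A sB B sD D)"

text \<open>
  For maps \<open>f\<close> with values in formal sums, \<open>tensor_left f\<close> is \<open>f \<otimes> id\<close> and \<open>tensor_right f\<close> is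
  \<open>id \<otimes> f\<close>.
\<close>

definition tensor_left :: "('a \<Rightarrow> ('b \<times> 'd \<Rightarrow>\<^sub>0 'k::field)) \<Rightarrow> ('a \<times> 'e \<Rightarrow>\<^sub>0 'k) \<Rightarrow> ('b \<times> 'd \<times> 'e \<Rightarrow>\<^sub>0 'k)"
  where "tensor_left f = flin fscale (\<lambda>(a, e). flin fscale (\<lambda>(b, d). fbasis (b, d, e)) (f a))"

definition tensor_right :: "('e \<Rightarrow> ('b \<times> 'd \<Rightarrow>\<^sub>0 'k::field)) \<Rightarrow> ('a \<times> 'e \<Rightarrow>\<^sub>0 'k) \<Rightarrow> ('a \<times> 'b \<times> 'd \<Rightarrow>\<^sub>0 'k)"
  where "tensor_right f = flin fscale (\<lambda>(a, e). flin fscale (\<lambda>(b, d). fbasis (a, b, d)) (f e))"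


section \<open>Coalgebras and comodules\<close>

text \<open>
  The underlying vector space of a coalgebra is a subspace \<open>cspace\<close> of the ambient type; the
  comultiplication is given by a choice of representing formal sums.
\<close>

record (overloaded) ('k::zero, 'c) coalg =
  cspace :: "'c set"
  cscale :: "'k \<Rightarrow> 'c \<Rightarrow> 'c"
  comult :: "'c \<Rightarrow> ('c \<times> 'c \<Rightarrow>\<^sub>0 'k)"
  counit :: "'c \<Rightarrow> 'k"

definition coalgebra :: "('k::field, 'c::ab_group_add) coalg \<Rightarrow> bool" where
  "coalgebra C \<longleftrightarrow>
     vector_space (cscale C) \<and> module.subspace (cscale C) (cspace C) \<and>
     (\<forall>c\<in>cspace C. Poly_Mapping.keys (comult C c) \<subseteq> cspace C \<times> cspace C) \<and>
     (\<forall>c\<in>cspace C. \<forall>d\<in>cspace C. tensor_eq (cscale C) (cspace C) (cscale C) (cspace C)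
        (comult C (c + d)) (comult C c + comult C d)) \<and>
     (\<forall>k. \<forall>c\<in>cspace C. tensor_eq (cscale C) (cspace C) (cscale C) (cspace C)
        (comult C (cscale C k c)) (fscale k (comult C c))) \<and>
     (\<forall>c\<in>cspace C. \<forall>d\<in>cspace C. counit C (c + d) = counit C c + counit C d) \<and>
     (\<forall>k. \<forall>c\<in>cspace C. counit C (cscale C k c) = k * counit C c) \<and>
     (\<forall>c\<in>cspace C. tensor3_eq (cscale C) (cspace C) (cscale C) (cspace C) (cscale C) (cspace C)
        (tensor_left (comult C) (comult C c)) (tensor_right (comult C) (comult C c))) \<and>
     (\<forall>c\<in>cspace C. flin (cscale C) (\<lambda>(a, b). cscale C (counit C a) b) (comult C c) = c) \<and>
     (\<forall>c\<in>cspace C. flin (cscale C) (\<lambda>(a, b). cscale C (counit C b) a) (comult C c) = c)"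

definition right_comodule ::
  "('k::field, 'c::ab_group_add) coalg \<Rightarrow> ('k \<Rightarrow> 'm::ab_group_add \<Rightarrow> 'm)
    \<Rightarrow> ('m \<Rightarrow> ('m \<times> 'c \<Rightarrow>\<^sub>0 'k)) \<Rightarrow> bool" where
  "right_comodule C s \<rho> \<longleftrightarrow>
     vector_space s \<and>
     (\<forall>m. Poly_Mapping.keys (\<rho> m) \<subseteq> UNIV \<times> cspace C) \<and>
     (\<forall>m n. tensor_eq s UNIV (cscale C) (cspace C) (\<rho> (m + n)) (\<rho> m + \<rho> n)) \<and>
     (\<forall>k m. tensor_eq s UNIV (cscale C) (cspace C) (\<rho> (s k m)) (fscale k (\<rho> m))) \<and>
     (\<forall>m. tensor3_eq s UNIV (cscale C) (cspace C) (cscale C) (cspace C)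
        (tensor_left \<rho> (\<rho> m)) (tensor_right (comult C) (\<rho> m))) \<and>
     (\<forall>m. flin s (\<lambda>(n, c). s (counit C c) n) (\<rho> m) = m)"

definition left_comodule ::
  "('k::field, 'c::ab_group_add) coalg \<Rightarrow> ('k \<Rightarrow> 'm::ab_group_add \<Rightarrow> 'm)
    \<Rightarrow> ('m \<Rightarrow> ('c \<times> 'm \<Rightarrow>\<^sub>0 'k)) \<Rightarrow> bool" where
  "left_comodule C s \<rho> \<longleftrightarrow>
     vector_space s \<and>
     (\<forall>m. Poly_Mapping.keys (\<rho> m) \<subseteq> cspace C \<times> UNIV) \<and>
     (\<forall>m n. tensor_eq (cscale C) (cspace C) s UNIV (\<rho> (m + n)) (\<rho> m + \<rho> n)) \<and>
     (\<forall>k m. tensor_eq (cscale C) (cspace C) s UNIV (\<rho> (s k m)) (fscale k (\<rho> m))) \<and>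
     (\<forall>m. tensor3_eq (cscale C) (cspace C) (cscale C) (cspace C) s UNIV
        (tensor_left (comult C) (\<rho> m)) (tensor_right \<rho> (\<rho> m))) \<and>
     (\<forall>m. flin s (\<lambda>(c, n). s (counit C c) n) (\<rho> m) = m)"


section \<open>The dual algebra and its modules\<close>

text \<open>
  A functional on the subspace \<open>cspace C\<close> is represented by the function on the ambient type that
  vanishes outside \<open>cspace C\<close>; addition and scalar multiplication are then pointwise.
\<close>

definition dual :: "('k::field, 'c::ab_group_add) coalg \<Rightarrow> ('c \<Rightarrow> 'k) set" where
  "dual C = {f. (\<forall>c\<in>cspace C. \<forall>d\<in>cspace C. f (c + d) = f c + f d) \<and>
                (\<forall>k. \<forall>c\<in>cspace C. f (cscale C k c) = k * f c) \<and>
                (\<forall>c. c \<notin> cspace C \<longrightarrow> f c = 0)}"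

definition conv :: "('k::field, 'c::ab_group_add) coalg \<Rightarrow> ('c \<Rightarrow> 'k) \<Rightarrow> ('c \<Rightarrow> 'k) \<Rightarrow> ('c \<Rightarrow> 'k)" where
  "conv C f g = (\<lambda>c. if c \<in> cspace C then flin (*) (\<lambda>(a, b). f a * g b) (comult C c) else 0)"

definition dual_unit :: "('k::field, 'c::ab_group_add) coalg \<Rightarrow> ('c \<Rightarrow> 'k)" where
  "dual_unit C = (\<lambda>c. if c \<in> cspace C then counit C c else 0)"

definition left_dual_module ::
  "('k::field, 'c::ab_group_add) coalg \<Rightarrow> ('k \<Rightarrow> 'm::ab_group_add \<Rightarrow> 'm)
    \<Rightarrow> (('c \<Rightarrow> 'k) \<Rightarrow> 'm \<Rightarrow> 'm) \<Rightarrow> bool" where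
  "left_dual_module C s act \<longleftrightarrow>
     vector_space s \<and>
     (\<forall>f\<in>dual C. \<forall>m n. act f (m + n) = act f m + act f n) \<and>
     (\<forall>f\<in>dual C. \<forall>g\<in>dual C. \<forall>m. act (\<lambda>c. f c + g c) m = act f m + act g m) \<and>
     (\<forall>k. \<forall>f\<in>dual C. \<forall>m. act (\<lambda>c. k * f c) m = s k (act f m)) \<and>
     (\<forall>k. \<forall>f\<in>dual C. \<forall>m. act f (s k m) = s k (act f m)) \<and>
     (\<forall>f\<in>dual C. \<forall>g\<in>dual C. \<forall>m. act (conv C f g) m = act f (act g m)) \<and>
     (\<forall>m. act (dual_unit C) m = m)"

definition right_dual_module ::
  "('k::field, 'c::ab_group_add) coalg \<Rightarrow> ('k \<Rightarrow> 'm::ab_group_add \<Rightarrow> 'm)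
    \<Rightarrow> ('m \<Rightarrow> ('c \<Rightarrow> 'k) \<Rightarrow> 'm) \<Rightarrow> bool" where
  "right_dual_module C s act \<longleftrightarrow>
     vector_space s \<and>
     (\<forall>f\<in>dual C. \<forall>m n. act (m + n) f = act m f + act n f) \<and>
     (\<forall>f\<in>dual C. \<forall>g\<in>dual C. \<forall>m. act m (\<lambda>c. f c + g c) = act m f + act m g) \<and>
     (\<forall>k. \<forall>f\<in>dual C. \<forall>m. act m (\<lambda>c. k * f c) = s k (act m f)) \<and>
     (\<forall>k. \<forall>f\<in>dual C. \<forall>m. act (s k m) f = s k (act m f)) \<and>
     (\<forall>f\<in>dual C. \<forall>g\<in>dual C. \<forall>m. act m (conv C f g) = act (act m f) g) \<and>
     (\<forall>m. act m (dual_unit C) = m)"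

definition rational_left ::
  "('k::field, 'c::ab_group_add) coalg \<Rightarrow> ('k \<Rightarrow> 'm::ab_group_add \<Rightarrow> 'm)
    \<Rightarrow> (('c \<Rightarrow> 'k) \<Rightarrow> 'm \<Rightarrow> 'm) \<Rightarrow> bool" where
  "rational_left C s act \<longleftrightarrow>
     left_dual_module C s act \<and>
     (\<exists>\<rho>. right_comodule C s \<rho> \<and>
        (\<forall>f\<in>dual C. \<forall>m. act f m = flin s (\<lambda>(n, c). s (f c) n) (\<rho> m)))"

definition rational_right ::
  "('k::field, 'c::ab_group_add) coalg \<Rightarrow> ('k \<Rightarrow> 'm::ab_group_add \<Rightarrow> 'm)
    \<Rightarrow> ('m \<Rightarrow> ('c \<Rightarrow> 'k) \<Rightarrow> 'm) \<Rightarrow> bool" where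
  "rational_right C s act \<longleftrightarrow>
     right_dual_module C s act \<and>
     (\<exists>\<rho>. left_comodule C s \<rho> \<and>
        (\<forall>f\<in>dual C. \<forall>m. act m f = flin s (\<lambda>(c, n). s (f c) n) (\<rho> m)))"

definition finite_dim :: "('k::field \<Rightarrow> 'm::ab_group_add \<Rightarrow> 'm) \<Rightarrow> bool" where
  "finite_dim s \<longleftrightarrow> (\<exists>B. finite_dimensional_vector_space s B)"

definition short_exact ::
  "('k::field \<Rightarrow> 'l::ab_group_add \<Rightarrow> 'l) \<Rightarrow> ('k \<Rightarrow> 'm::ab_group_add \<Rightarrow> 'm)
    \<Rightarrow> ('k \<Rightarrow> 'n::ab_group_add \<Rightarrow> 'n) \<Rightarrow> ('l \<Rightarrow> 'm) \<Rightarrow> ('m \<Rightarrow> 'n) \<Rightarrow> bool" where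
  "short_exact sL sM sN i p \<longleftrightarrow>
     Vector_Spaces.linear sL sM i \<and> Vector_Spaces.linear sM sN p \<and>
     inj i \<and> surj p \<and> range i = {m. p m = 0}"

text \<open>\<open>M\<close> is an extension of \<open>N\<close> by \<open>L\<close>: an exact sequence \<open>0 \<rightarrow> L \<rightarrow> M \<rightarrow> N \<rightarrow> 0\<close> of modules.\<close>

definition left_extension ::
  "('k::field, 'c::ab_group_add) coalg
    \<Rightarrow> ('k \<Rightarrow> 'l::ab_group_add \<Rightarrow> 'l) \<Rightarrow> (('c \<Rightarrow> 'k) \<Rightarrow> 'l \<Rightarrow> 'l)
    \<Rightarrow> ('k \<Rightarrow> 'm::ab_group_add \<Rightarrow> 'm) \<Rightarrow> (('c \<Rightarrow> 'k) \<Rightarrow> 'm \<Rightarrow> 'm)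
    \<Rightarrow> ('k \<Rightarrow> 'n::ab_group_add \<Rightarrow> 'n) \<Rightarrow> (('c \<Rightarrow> 'k) \<Rightarrow> 'n \<Rightarrow> 'n) \<Rightarrow> bool" where
  "left_extension C sL actL sM actM sN actN \<longleftrightarrow>
     left_dual_module C sL actL \<and> left_dual_module C sM actM \<and> left_dual_module C sN actN \<and>
     (\<exists>i p. short_exact sL sM sN i p \<and>
        (\<forall>f\<in>dual C. \<forall>x. i (actL f x) = actM f (i x)) \<and>
        (\<forall>f\<in>dual C. \<forall>x. p (actM f x) = actN f (p x)))"

definition right_extension ::
  "('k::field, 'c::ab_group_add) coalg
    \<Rightarrow> ('k \<Rightarrow> 'l::ab_group_add \<Rightarrow> 'l) \<Rightarrow> ('l \<Rightarrow> ('c \<Rightarrow> 'k) \<Rightarrow> 'l)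
    \<Rightarrow> ('k \<Rightarrow> 'm::ab_group_add \<Rightarrow> 'm) \<Rightarrow> ('m \<Rightarrow> ('c \<Rightarrow> 'k) \<Rightarrow> 'm)
    \<Rightarrow> ('k \<Rightarrow> 'n::ab_group_add \<Rightarrow> 'n) \<Rightarrow> ('n \<Rightarrow> ('c \<Rightarrow> 'k) \<Rightarrow> 'n) \<Rightarrow> bool" where
  "right_extension C sL actL sM actM sN actN \<longleftrightarrow>
     right_dual_module C sL actL \<and> right_dual_module C sM actM \<and> right_dual_module C sN actN \<and>
     (\<exists>i p. short_exact sL sM sN i p \<and>
        (\<forall>f\<in>dual C. \<forall>x. i (actL x f) = actM (i x) f) \<and>
        (\<forall>f\<in>dual C. \<forall>x. p (actM x f) = actN (p x) f))"

text \<open>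
  A definition in HOL cannot quantify over types, so the three type arguments name the types on which
  the modules \<open>L\<close>, \<open>M\<close>, \<open>N\<close> of an extension live. Closure under all extensions is the statement for
  arbitrary such types, i.e. with type variables in these places.
\<close>

definition rational_left_closed_under_extensions ::
  "('k::field, 'c::ab_group_add) coalg
    \<Rightarrow> 'l::ab_group_add itself \<Rightarrow> 'm::ab_group_add itself \<Rightarrow> 'n::ab_group_add itself \<Rightarrow> bool" where
  "rational_left_closed_under_extensions C TL TM TN \<longleftrightarrow>
     (\<forall>(sL :: 'k \<Rightarrow> 'l \<Rightarrow> 'l) actL (sM :: 'k \<Rightarrow> 'm \<Rightarrow> 'm) actM (sN :: 'k \<Rightarrow> 'n \<Rightarrow> 'n) actN.
        left_extension C sL actL sM actM sN actN \<longrightarrow>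
        rational_left C sL actL \<longrightarrow> rational_left C sN actN \<longrightarrow> rational_left C sM actM)"

definition rational_right_closed_under_extensions ::
  "('k::field, 'c::ab_group_add) coalg
    \<Rightarrow> 'l::ab_group_add itself \<Rightarrow> 'm::ab_group_add itself \<Rightarrow> 'n::ab_group_add itself \<Rightarrow> bool" where
  "rational_right_closed_under_extensions C TL TM TN \<longleftrightarrow>
     (\<forall>(sL :: 'k \<Rightarrow> 'l \<Rightarrow> 'l) actL (sM :: 'k \<Rightarrow> 'm \<Rightarrow> 'm) actM (sN :: 'k \<Rightarrow> 'n \<Rightarrow> 'n) actN.
        right_extension C sL actL sM actM sN actN \<longrightarrow>
        rational_right C sL actL \<longrightarrow> rational_right C sN actN \<longrightarrow> rational_right C sM actM)"

definition directly_coreflexive ::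
  "('k::field, 'c::ab_group_add) coalg
    \<Rightarrow> 'l::ab_group_add itself \<Rightarrow> 'm::ab_group_add itself \<Rightarrow> 'n::ab_group_add itself \<Rightarrow> bool" where
  "directly_coreflexive C TL TM TN \<longleftrightarrow>
     coalgebra C \<and>
     (\<forall>(sL :: 'k \<Rightarrow> 'l \<Rightarrow> 'l) actL (sM :: 'k \<Rightarrow> 'm \<Rightarrow> 'm) actM (sN :: 'k \<Rightarrow> 'n \<Rightarrow> 'n) actN.
        left_extension C sL actL sM actM sN actN \<longrightarrow>
        rational_left C sL actL \<and> finite_dim sL \<longrightarrow>
        rational_left C sN actN \<and> finite_dim sN \<longrightarrow>
        rational_left C sM actM \<and> finite_dim sM)"


section \<open>Path coalgebras\<close>

text \<open>
  A quiver is a \<^const>\<open>wf_digraph\<close>: loops, multiple arrows and infinite vertex and arrow sets are all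
  allowed. A path is a pair of its starting vertex and its list of arrows (in order of traversal);
  \<open>(v, [])\<close> is the vertex \<open>v\<close> regarded as a path of length 0.
\<close>

type_synonym ('v, 'e) qpath = "'v \<times> 'e list"

definition quiver_paths :: "('v, 'e) pre_digraph \<Rightarrow> ('v, 'e) qpath set" where
  "quiver_paths Q = {(u, es). \<exists>v. pre_digraph.awalk Q u es v}"

definition path_source :: "('v, 'e) qpath \<Rightarrow> 'v" where
  "path_source p = fst p"

definition path_target :: "('v, 'e) pre_digraph \<Rightarrow> ('v, 'e) qpath \<Rightarrow> 'v" where
  "path_target Q p = pre_digraph.awlast Q (fst p) (snd p)"

definition factorizations ::
  "('v, 'e) pre_digraph \<Rightarrow> ('v, 'e) qpath \<Rightarrow> (('v, 'e) qpath \<times> ('v, 'e) qpath) set" where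
  "factorizations Q r = {(p, q). p \<in> quiver_paths Q \<and> q \<in> quiver_paths Q \<and>
     path_target Q p = path_source q \<and> r = (path_source p, snd p @ snd q)}"

definition subpath :: "('v, 'e) pre_digraph \<Rightarrow> ('v, 'e) qpath \<Rightarrow> ('v, 'e) qpath \<Rightarrow> bool" where
  "subpath Q q r \<longleftrightarrow> (\<exists>a b c. (a, b) \<in> factorizations Q r \<and> (q, c) \<in> factorizations Q b)"

definition subpath_closed :: "('v, 'e) pre_digraph \<Rightarrow> ('v, 'e) qpath set \<Rightarrow> bool" where
  "subpath_closed Q H \<longleftrightarrow> (\<forall>r\<in>H. \<forall>q. subpath Q q r \<longrightarrow> q \<in> H)"

definition path_coalgebra :: "('v, 'e) pre_digraph \<Rightarrow> ('k::field, ('v, 'e) qpath \<Rightarrow>\<^sub>0 'k) coalg" where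
  "path_coalgebra Q = \<lparr>
     cspace = module.span fscale (fbasis ` quiver_paths Q),
     cscale = fscale,
     comult = flin fscale (\<lambda>r. \<Sum>(p, q)\<in>factorizations Q r. fbasis (fbasis p, fbasis q)),
     counit = flin (*) (\<lambda>p. if length (snd p) = 0 then 1 else 0) \<rparr>"

definition monomial_coalgebra ::
  "('v, 'e) pre_digraph \<Rightarrow> ('v, 'e) qpath set \<Rightarrow> ('k::field, ('v, 'e) qpath \<Rightarrow>\<^sub>0 'k) coalg" where
  "monomial_coalgebra Q H = (path_coalgebra Q)\<lparr>cspace := module.span fscale (fbasis ` H)\<rparr>"


subsection \<open>Monomial coalgebras are coalgebras\<close>

lemma lookup_fscale: "Poly_Mapping.lookup (fscale k x) a = k * Poly_Mapping.lookup x a"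
  unfolding fscale_def by (simp add: Poly_Mapping.map.rep_eq when_def)

lemma fscale_zero_left: "fscale 0 x = 0"
  by (rule poly_mapping_eqI) (simp add: lookup_fscale)

lemma vector_space_fscale: "vector_space (fscale :: 'k::field \<Rightarrow> ('a \<Rightarrow>\<^sub>0 'k) \<Rightarrow> _)"
  by unfold_locales (auto intro!: poly_mapping_eqI simp: lookup_fscale lookup_add algebra_simps)

lemma vector_space_mult: "vector_space ((*) :: 'k::field \<Rightarrow> 'k \<Rightarrow> 'k)"
  by unfold_locales (auto simp: algebra_simps)

lemma flin_superset:
  assumes "vector_space s" "finite S" "Poly_Mapping.keys x \<subseteq> S"
  shows "flin s g x = (\<Sum>a\<in>S. s (Poly_Mapping.lookup x a) (g a))"
proof -
  interpret vector_space s by fact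
  show ?thesis
    unfolding flin_def using assms(2,3)
    by (intro sum.mono_neutral_left) (auto simp: in_keys_iff)
qed

lemma keys_fscale: "Poly_Mapping.keys (fscale k x) \<subseteq> Poly_Mapping.keys x"
  by (auto simp: in_keys_iff lookup_fscale)

lemma linear_flin:
  assumes "vector_space s"
  shows "Vector_Spaces.linear fscale s (flin s g)"
proof -
  interpret vector_space s by fact
  have "flin s g (x + y) = flin s g x + flin s g y" for x y
  proof -
    let ?S = "Poly_Mapping.keys x \<union> Poly_Mapping.keys y"
    have "flin s g (x + y) = (\<Sum>a\<in>?S. s (Poly_Mapping.lookup (x + y) a) (g a))"
      by (rule flin_superset[OF assms]) (use keys_add[of x y] in auto)
    also have "\<dots> = flin s g x + flin s g y"
      by (simp add: flin_superset[OF assms, of ?S] lookup_add scale_left_distrib sum.distrib)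
    finally show ?thesis .
  qed
  moreover have "flin s g (fscale k x) = s k (flin s g x)" for k x
    by (subst flin_superset[OF assms finite_keys keys_fscale])
      (simp add: lookup_fscale flin_def scale_sum_right)
  ultimately show ?thesis
    by (intro Vector_Spaces.linear.intro module_hom.intro module_hom_axioms.intro
        vector_space_fscale assms) (simp_all add: module_iff_vector_space vector_space_fscale assms)
qed

lemma flin_sum:
  assumes "vector_space s"
  shows "flin s g (\<Sum>i\<in>I. x i) = (\<Sum>i\<in>I. flin s g (x i))"
proof -
  interpret Vector_Spaces.linear fscale s "flin s g" using assms by (rule linear_flin)
  show ?thesis by (rule sum)
qed

lemma flin_fbasis:
  assumes "vector_space s"
  shows "flin s g (fbasis a) = g a"
proof -
  interpret vector_space s by fact
  show ?thesis by (simp add: flin_def)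
qed

lemma keys_flin:
  "Poly_Mapping.keys (flin fscale g x) \<subseteq> (\<Union>a\<in>Poly_Mapping.keys x. Poly_Mapping.keys (g a))"
  unfolding flin_def by (rule order_trans[OF keys_sum]) (use keys_fscale in fast)

lemma span_fbasis:
  "module.span fscale (fbasis ` H) = {x :: 'a \<Rightarrow>\<^sub>0 'k::field. Poly_Mapping.keys x \<subseteq> H}"
proof -
  interpret vector_space "fscale :: 'k \<Rightarrow> ('a \<Rightarrow>\<^sub>0 'k) \<Rightarrow> _" by (rule vector_space_fscale)
  show ?thesis
  proof (rule set_eqI, rule iffI)
    fix x :: "'a \<Rightarrow>\<^sub>0 'k" assume "x \<in> span (fbasis ` H)"
    moreover have "subspace {x :: 'a \<Rightarrow>\<^sub>0 'k. Poly_Mapping.keys x \<subseteq> H}"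
    proof (rule subspaceI)
      show "x + y \<in> {x. Poly_Mapping.keys x \<subseteq> H}"
        if "x \<in> {x. Poly_Mapping.keys x \<subseteq> H}" "y \<in> {x. Poly_Mapping.keys x \<subseteq> H}"
        for x y :: "'a \<Rightarrow>\<^sub>0 'k"
        using that keys_add[of x y] by blast
      show "fscale c x \<in> {x. Poly_Mapping.keys x \<subseteq> H}"
        if "x \<in> {x. Poly_Mapping.keys x \<subseteq> H}" for c and x :: "'a \<Rightarrow>\<^sub>0 'k"
        using that keys_fscale[of c x] by blast
    qed simp
    moreover have "fbasis ` H \<subseteq> {x :: 'a \<Rightarrow>\<^sub>0 'k. Poly_Mapping.keys x \<subseteq> H}" by auto
    ultimately show "x \<in> {x. Poly_Mapping.keys x \<subseteq> H}" using span_minimal by blast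
  next
    fix x :: "'a \<Rightarrow>\<^sub>0 'k" assume "x \<in> {x. Poly_Mapping.keys x \<subseteq> H}"
    hence H: "Poly_Mapping.keys x \<subseteq> H" by simp
    have "x = flin fscale fbasis x"
      by (rule poly_mapping_eqI)
        (simp add: flin_def lookup_sum lookup_fscale lookup_single when_def in_keys_iff
          if_distrib cong: if_cong)
    also have "\<dots> \<in> span (fbasis ` H)"
      unfolding flin_def using H by (intro span_sum span_scale span_base) auto
    finally show "x \<in> span (fbasis ` H)" .
  qed
qed

lemma flin_eq_on_span:
  fixes x :: "'b \<Rightarrow>\<^sub>0 'a::field"
  assumes "Vector_Spaces.linear fscale s f" "Vector_Spaces.linear fscale s g"
    and "\<And>r. r \<in> H \<Longrightarrow> f (fbasis r) = g (fbasis r)"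
    and "x \<in> module.span fscale (fbasis ` H)"
  shows "f x = g x"
proof -
  interpret f: Vector_Spaces.linear fscale s f by fact
  have "vector_space_pair (fscale :: 'a \<Rightarrow> ('b \<Rightarrow>\<^sub>0 'a) \<Rightarrow> _) s"
    by (intro vector_space_pair.intro vector_space_fscale f.vs2.vector_space_axioms)
  thus ?thesis
    by (rule vector_space_pair.linear_eq_on_span[OF _ assms(1,2) _ assms(4)]) (use assms(3) in auto)
qed

context wf_digraph
begin

lemma vertex_path: "v \<in> verts G \<Longrightarrow> (v, []) \<in> quiver_paths G"
  by (auto simp: quiver_paths_def awalk_def)

lemma quiver_pathsD:
  assumes "p \<in> quiver_paths G"
  shows "awalk (path_source p) (snd p) (path_target G p)"
    and "path_source p \<in> verts G" "path_target G p \<in> verts G"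
proof -
  obtain v where v: "awalk (fst p) (snd p) v"
    using assms by (auto simp: quiver_paths_def)
  moreover have "awlast (fst p) (snd p) = v" using v by simp
  ultimately show "awalk (path_source p) (snd p) (path_target G p)"
    by (simp add: path_source_def path_target_def)
  thus "path_source p \<in> verts G" "path_target G p \<in> verts G"
    by (auto simp: awalk_hd_in_verts awalk_last_in_verts)
qed

lemma path_target_append:
  "path_target G p = path_source q \<Longrightarrow>
    path_target G (path_source p, snd p @ snd q) = path_target G q"
  unfolding path_source_def path_target_def
  by (cases p; cases q) (auto simp: awalk_verts_conv)

lemma factorizations_path:
  assumes "(p, q) \<in> factorizations G r"
  shows "r \<in> quiver_paths G" "path_target G r = path_target G q" "path_source r = path_source p"
proof -
  have *: "p \<in> quiver_paths G" "q \<in> quiver_paths G" "path_target G p = path_source q"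
    "r = (path_source p, snd p @ snd q)"
    using assms by (auto simp: factorizations_def)
  have "awalk (path_source p) (snd p @ snd q) (path_target G q)"
    using quiver_pathsD(1)[OF *(1)] quiver_pathsD(1)[OF *(2)] *(3) by auto
  thus "r \<in> quiver_paths G" using *(4) by (auto simp: quiver_paths_def)
  show "path_target G r = path_target G q" using path_target_append[OF *(3)] *(4) by simp
  show "path_source r = path_source p" using *(4) by (simp add: path_source_def)
qed

lemma finite_factorizations: "finite (factorizations G r)"
proof (rule finite_subset)
  let ?f = "\<lambda>i. ((fst r, take i (snd r)), (awlast (fst r) (take i (snd r)), drop i (snd r)))"
  show "factorizations G r \<subseteq> ?f ` {..length (snd r)}"
  proof
    fix z assume "z \<in> factorizations G r"
    then obtain p q where z: "z = (p, q)" "path_target G p = path_source q"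
      "r = (path_source p, snd p @ snd q)"
      by (auto simp: factorizations_def)
    have "z = ?f (length (snd p))"
      using z by (simp add: path_source_def path_target_def prod_eq_iff)
    moreover have "length (snd p) \<in> {..length (snd r)}" using z by simp
    ultimately show "z \<in> ?f ` {..length (snd r)}" by (rule image_eqI)
  qed
qed simp

lemma source_factorization:
  "r \<in> quiver_paths G \<Longrightarrow> ((path_source r, []), r) \<in> factorizations G r"
  using quiver_pathsD[of r]
  by (auto simp: factorizations_def vertex_path path_source_def path_target_def)

lemma target_factorization:
  "r \<in> quiver_paths G \<Longrightarrow> (r, (path_target G r, [])) \<in> factorizations G r"
  using quiver_pathsD[of r]
  by (auto simp: factorizations_def vertex_path path_source_def)

lemma subpath_closed_factorizations:
  assumes "subpath_closed G H" "r \<in> H" "(p, q) \<in> factorizations G r"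
  shows "p \<in> H" "q \<in> H"
proof -
  have r: "r \<in> quiver_paths G" using assms(3) by (rule factorizations_path(1))
  have q: "q \<in> quiver_paths G" using assms(3) by (simp add: factorizations_def)
  have "subpath G p r"
    unfolding subpath_def using source_factorization[OF r] assms(3) by blast
  moreover have "subpath G q r"
    unfolding subpath_def using target_factorization[OF q] assms(3) by blast
  ultimately show "p \<in> H" "q \<in> H" using assms(1,2) unfolding subpath_closed_def by blast+
qed

lemma factorizations_assoc:
  "(p, q) \<in> factorizations G r \<and> (p1, p2) \<in> factorizations G p \<and> q = q2 \<and> p2 = q1 \<Longrightarrow>
   \<exists>u. (p1, u) \<in> factorizations G r \<and> (q1, q2) \<in> factorizations G u"
proof -
  assume a: "(p, q) \<in> factorizations G r \<and> (p1, p2) \<in> factorizations G p \<and> q = q2 \<and> p2 = q1"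
  let ?u = "(path_source q1, snd q1 @ snd q2)"
  have "(q1, q2) \<in> factorizations G ?u"
    using a factorizations_path(2)[of p1 p2 p] by (auto simp: factorizations_def)
  moreover from this have "(p1, ?u) \<in> factorizations G r"
    using a factorizations_path[of q1 q2 ?u] factorizations_path(3)[of p1 p2 p]
    by (auto simp: factorizations_def path_source_def)
  ultimately show ?thesis by blast
qed

lemma factorizations_assoc':
  assumes "(p, u) \<in> factorizations G r" "(q1, q2) \<in> factorizations G u"
  shows "\<exists>w. (w, q2) \<in> factorizations G r \<and> (p, q1) \<in> factorizations G w"
proof -
  let ?w = "(path_source p, snd p @ snd q1)"
  have "(p, q1) \<in> factorizations G ?w"
    using assms factorizations_path(3)[of q1 q2 u] by (auto simp: factorizations_def)
  moreover have "snd u = snd q1 @ snd q2"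
    using assms(2) by (cases u) (simp add: factorizations_def)
  ultimately have "(?w, q2) \<in> factorizations G r" "(p, q1) \<in> factorizations G ?w"
    using assms factorizations_path[of p q1 ?w] factorizations_path(3)[of q1 q2 u]
    by (auto simp: factorizations_def path_source_def)
  thus ?thesis by blast
qed

lemma sum_factorizations_assoc:
  "(\<Sum>(p, q)\<in>factorizations G r. \<Sum>(p1, p2)\<in>factorizations G p. F p1 p2 q) =
   (\<Sum>(p, q)\<in>factorizations G r. \<Sum>(q1, q2)\<in>factorizations G q. F p q1 q2)"
proof -
  let ?f = "factorizations G"
  have "(\<Sum>(p, q)\<in>?f r. \<Sum>(p1, p2)\<in>?f p. F p1 p2 q) =
        (\<Sum>((p, q), (p1, p2))\<in>Sigma (?f r) (\<lambda>(p, q). ?f p). F p1 p2 q)"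
    by (subst sum.Sigma[symmetric]) (auto simp: finite_factorizations split_def)
  also have "\<dots> = (\<Sum>((p, q), (q1, q2))\<in>Sigma (?f r) (\<lambda>(p, q). ?f q). F p q1 q2)"
  proof -
    let ?i = "\<lambda>((p, u), (q1, q2)). (((path_source p, snd p @ snd q1), q2), (p, q1))"
    let ?j = "\<lambda>((w, q), (p1, p2)). ((p1, (path_source p2, snd p2 @ snd q)), (p2, q))"
    let ?g = "\<lambda>((p, q), (p1, p2)). F p1 p2 q" and ?h = "\<lambda>((p, q), (q1, q2)). F p q1 q2"
    let ?S = "Sigma (?f r) (\<lambda>(p, q). ?f p)" and ?T = "Sigma (?f r) (\<lambda>(p, q). ?f q)"
    have *: "?i (?j a) = a \<and> ?j a \<in> ?T \<and> ?h (?j a) = ?g a" if "a \<in> ?S" for a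
    proof -
      obtain w q p1 p2 where a: "a = ((w, q), (p1, p2))" "(w, q) \<in> ?f r" "(p1, p2) \<in> ?f w"
        using \<open>a \<in> ?S\<close> by auto
      obtain u where u: "(p1, u) \<in> ?f r" "(p2, q) \<in> ?f u"
        using factorizations_assoc a(2,3) by blast
      moreover have "u = (path_source p2, snd p2 @ snd q)" "w = (path_source p1, snd p1 @ snd p2)"
        using u(2) a(3) by (auto simp: factorizations_def)
      ultimately show ?thesis using a by auto
    qed
    have **: "?j (?i b) = b \<and> ?i b \<in> ?S" if "b \<in> ?T" for b
    proof -
      obtain p u q1 q2 where b: "b = ((p, u), (q1, q2))" "(p, u) \<in> ?f r" "(q1, q2) \<in> ?f u"
        using \<open>b \<in> ?T\<close> by auto
      obtain w where w: "(w, q2) \<in> ?f r" "(p, q1) \<in> ?f w"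
        using factorizations_assoc' b(2,3) by blast
      moreover have "w = (path_source p, snd p @ snd q1)" "u = (path_source q1, snd q1 @ snd q2)"
        using w(2) b(3) by (auto simp: factorizations_def)
      ultimately show ?thesis using b by auto
    qed
    show ?thesis
      by (rule sum.reindex_bij_witness[of _ ?i ?j]) (use * ** in blast)+
  qed
  also have "\<dots> = (\<Sum>(p, q)\<in>?f r. \<Sum>(q1, q2)\<in>?f q. F p q1 q2)"
    by (subst sum.Sigma[symmetric]) (auto simp: finite_factorizations split_def)
  finally show ?thesis .
qed

lemma coalgebra_monomial_coalgebra:
  assumes H: "H \<subseteq> quiver_paths G" "subpath_closed G H"
  shows "coalgebra (monomial_coalgebra G H :: ('k::field, _) coalg)"
proof -
  let ?D = "\<lambda>r. \<Sum>(p, q)\<in>factorizations G r.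
    (fbasis (fbasis p, fbasis q) :: (('a, 'b) qpath \<Rightarrow>\<^sub>0 'k) \<times> (('a, 'b) qpath \<Rightarrow>\<^sub>0 'k) \<Rightarrow>\<^sub>0 'k)"
  let ?e = "\<lambda>p :: ('a, 'b) qpath. if length (snd p) = 0 then 1 else 0 :: 'k"
  define \<Delta> where "\<Delta> = flin fscale ?D"
  define \<epsilon> where "\<epsilon> = flin (*) ?e"
  define S :: "(('a, 'b) qpath \<Rightarrow>\<^sub>0 'k) set" where "S = module.span fscale (fbasis ` H)"
  have C: "monomial_coalgebra G H = \<lparr>cspace = S, cscale = fscale, comult = \<Delta>, counit = \<epsilon>\<rparr>"
    by (simp add: monomial_coalgebra_def path_coalgebra_def S_def \<Delta>_def \<epsilon>_def)
  note vf = vector_space_fscale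
  interpret \<Delta>: Vector_Spaces.linear fscale fscale \<Delta> unfolding \<Delta>_def by (rule linear_flin[OF vf])
  interpret \<epsilon>: Vector_Spaces.linear fscale "(*)" \<epsilon>
    unfolding \<epsilon>_def by (rule linear_flin[OF vector_space_mult])
  have lin: "Vector_Spaces.linear fscale fscale (\<lambda>c. flin fscale g (\<Delta> c))"
    for g :: "(('a, 'b) qpath \<Rightarrow>\<^sub>0 'k) \<times> (('a, 'b) qpath \<Rightarrow>\<^sub>0 'k) \<Rightarrow> ('z \<Rightarrow>\<^sub>0 'k)"
    using Vector_Spaces.linear_compose[OF \<Delta>.linear_axioms linear_flin[OF vf, of g]] by (simp add: o_def)
  have id: "Vector_Spaces.linear fscale fscale (\<lambda>c :: ('a, 'b) qpath \<Rightarrow>\<^sub>0 'k. c)"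
    by (rule vector_space.linear_ident[OF vf])
  have \<Delta>b: "\<Delta> (fbasis r) = ?D r" for r unfolding \<Delta>_def by (rule flin_fbasis[OF vf])
  have \<epsilon>b: "\<epsilon> (fbasis r) = ?e r" for r unfolding \<epsilon>_def by (rule flin_fbasis[OF vector_space_mult])
  have flD: "flin fscale g (\<Delta> (fbasis r)) = (\<Sum>(p, q)\<in>factorizations G r. g (fbasis p, fbasis q))"
    for g :: "(('a, 'b) qpath \<Rightarrow>\<^sub>0 'k) \<times> (('a, 'b) qpath \<Rightarrow>\<^sub>0 'k) \<Rightarrow> ('z \<Rightarrow>\<^sub>0 'k)" and r
    unfolding \<Delta>b flin_sum[OF vf] by (intro sum.cong refl) (auto simp: flin_fbasis[OF vf])

  have keys: "Poly_Mapping.keys (\<Delta> c) \<subseteq> S \<times> S" if "c \<in> S" for c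
  proof -
    have "Poly_Mapping.keys c \<subseteq> H" using that by (simp add: S_def span_fbasis)
    moreover have "Poly_Mapping.keys (?D r) \<subseteq> S \<times> S" if "r \<in> H" for r
    proof (rule order_trans[OF keys_sum], rule UN_least)
      fix z assume "z \<in> factorizations G r"
      then obtain p q where z: "z = (p, q)" "p \<in> H" "q \<in> H"
        using subpath_closed_factorizations[OF H(2) \<open>r \<in> H\<close>] by (cases z) auto
      let ?t = "fbasis (fbasis p, fbasis q) ::
        (('a, 'b) qpath \<Rightarrow>\<^sub>0 'k) \<times> (('a, 'b) qpath \<Rightarrow>\<^sub>0 'k) \<Rightarrow>\<^sub>0 'k"
      have "Poly_Mapping.keys ?t \<subseteq> S \<times> S" using z by (simp add: S_def span_fbasis)
      thus "Poly_Mapping.keys (case z of (p, q) \<Rightarrow> (fbasis (fbasis p, fbasis q) ::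
        (('a, 'b) qpath \<Rightarrow>\<^sub>0 'k) \<times> (('a, 'b) qpath \<Rightarrow>\<^sub>0 'k) \<Rightarrow>\<^sub>0 'k)) \<subseteq> S \<times> S"
        using z by simp
    qed
    ultimately show ?thesis unfolding \<Delta>_def using keys_flin[of ?D c] by blast
  qed

  have coassoc: "tensor_left \<Delta> (\<Delta> c) = tensor_right \<Delta> (\<Delta> c)" if "c \<in> S" for c
  proof (rule flin_eq_on_span[where f = "\<lambda>c. tensor_left \<Delta> (\<Delta> c)" and g = "\<lambda>c. tensor_right \<Delta> (\<Delta> c)",
        OF _ _ _ that[unfolded S_def]])
    show "Vector_Spaces.linear fscale fscale (\<lambda>c. tensor_left \<Delta> (\<Delta> c))"
      "Vector_Spaces.linear fscale fscale (\<lambda>c. tensor_right \<Delta> (\<Delta> c))"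
      unfolding tensor_left_def tensor_right_def by (rule lin)+
    show "tensor_left \<Delta> (\<Delta> (fbasis r)) = tensor_right \<Delta> (\<Delta> (fbasis r))" for r
      unfolding tensor_left_def tensor_right_def by (simp add: flD sum_factorizations_assoc)
  qed

  have counit1: "flin fscale (\<lambda>(a, b). fscale (\<epsilon> a) b) (\<Delta> c) = c" if "c \<in> S" for c
  proof (rule flin_eq_on_span[where g = "\<lambda>c. c", OF lin id _ that[unfolded S_def]])
    fix r assume r: "r \<in> H"
    have "(\<Sum>z\<in>factorizations G r. fscale (?e (fst z)) (fbasis (snd z) :: _ \<Rightarrow>\<^sub>0 'k)) =
          (\<Sum>z\<in>{((path_source r, []), r)}. fscale (?e (fst z)) (fbasis (snd z)))"
    proof (rule sum.mono_neutral_right[OF finite_factorizations])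
      show "{((path_source r, []), r)} \<subseteq> factorizations G r"
        using source_factorization r H(1) by blast
    qed (auto simp: factorizations_def path_source_def path_target_def fscale_zero_left)
    thus "flin fscale (\<lambda>(a, b). fscale (\<epsilon> a) b) (\<Delta> (fbasis r)) = fbasis r"
      by (simp add: flD \<epsilon>b split_def vector_space.vector_space_assms(4)[OF vf])
  qed

  have counit2: "flin fscale (\<lambda>(a, b). fscale (\<epsilon> b) a) (\<Delta> c) = c" if "c \<in> S" for c
  proof (rule flin_eq_on_span[where g = "\<lambda>c. c", OF lin id _ that[unfolded S_def]])
    fix r assume r: "r \<in> H"
    have "(\<Sum>z\<in>factorizations G r. fscale (?e (snd z)) (fbasis (fst z) :: _ \<Rightarrow>\<^sub>0 'k)) =
          (\<Sum>z\<in>{(r, (path_target G r, []))}. fscale (?e (snd z)) (fbasis (fst z)))"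
    proof (rule sum.mono_neutral_right[OF finite_factorizations])
      show "{(r, (path_target G r, []))} \<subseteq> factorizations G r"
        using target_factorization r H(1) by blast
    qed (auto simp: factorizations_def path_source_def fscale_zero_left)
    thus "flin fscale (\<lambda>(a, b). fscale (\<epsilon> b) a) (\<Delta> (fbasis r)) = fbasis r"
      by (simp add: flD \<epsilon>b split_def vector_space.vector_space_assms(4)[OF vf])
  qed

  have "module.subspace fscale S" unfolding S_def
    by (rule module.subspace_span[OF vf[folded module_iff_vector_space]])
  thus ?thesis
    unfolding coalgebra_def C tensor_eq_def tensor3_eq_def
    using keys
    by (auto simp: vf \<Delta>.add \<Delta>.scale \<epsilon>.add \<epsilon>.scale coassoc counit1 counit2
        module.span_zero[OF vf[folded module_iff_vector_space]])
qed

end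

end

theory Submission
  imports Defs "HOL-Library.Indicator_Function"
begin

text \<open>
  Since \<open>H\<close> is a basis of \<open>C\<close>, elements of \<open>C\<^sup>*\<close> are arbitrary functions \<open>\<phi>\<close> on \<open>H\<close>, and a module is
  rational iff each of its elements is killed by all \<open>\<phi>\<close> vanishing on some finite \<open>F \<subseteq> H\<close>. In an
  extension of \<open>N\<close> by \<open>L\<close> take \<open>m \<in> M\<close> and \<open>F\<close> that works for the image of \<open>m\<close> in \<open>N\<close>, so that
  \<open>\<phi> m \<in> L\<close> for every \<open>\<phi>\<close> vanishing on \<open>F\<close>. Let \<open>e\<close> be the sum of the idempotents of the finite set
  \<open>W\<close> of vertices in \<open>F\<close>. Then \<open>(1 - e) m\<close> is in \<open>L\<close>, which handles \<open>\<phi> (1 - e) m\<close>, while \<open>\<phi> e\<close> lives on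
  paths ending in \<open>W\<close>. Only finitely many sources \<open>v\<close> admit some \<open>\<phi>\<close> that vanishes on \<open>F\<close>, lives on the
  paths from \<open>v\<close> to \<open>W\<close> and satisfies \<open>\<phi> m \<noteq> 0\<close>: one such \<open>\<phi>\<close> per \<open>v\<close> glue to a single function
  \<open>\<Phi>\<close>, and \<open>\<Phi> m \<in> L\<close> has only finitely many nonzero components \<open>e\<^sub>v \<Phi> m\<close>. Adding to \<open>F\<close> the paths from
  these sources to \<open>W\<close>, which are finite in number by hypothesis, gives a finite set that works for \<open>m\<close>.
\<close>

section \<open>Elements annihilated by functions vanishing on a finite set\<close>

text \<open>Openness of the annihilator of m in the finite topology of the dual, written in
  coordinates: \<open>act\<close> takes functions on paths, so that left and right actions can be
  treated alike and no coalgebra occurs.\<close>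

definition cofin_ann :: "'p set \<Rightarrow> (('p \<Rightarrow> 'k::zero) \<Rightarrow> 'm \<Rightarrow> 'm::zero) \<Rightarrow> 'm \<Rightarrow> bool" where
  "cofin_ann H act m \<longleftrightarrow>
     (\<exists>F. finite F \<and> F \<subseteq> H \<and> (\<forall>\<phi>. (\<forall>p\<in>F. \<phi> p = 0) \<longrightarrow> act \<phi> m = 0))"

text \<open>Of the multiplication only products with the vertex idempotents \<open>ev V\<close>
  enter: one order of composition cuts a function down by \<open>src\<close>, the other by
  \<open>tgt\<close>. Left modules take source and target for these, right modules the
  reverse.\<close>

lemma cofin_ann_extension:
  fixes actL :: "('p \<Rightarrow> 'k::ring_1) \<Rightarrow> 'l::ab_group_add \<Rightarrow> 'l"
    and actM :: "('p \<Rightarrow> 'k) \<Rightarrow> 'm::ab_group_add \<Rightarrow> 'm"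
    and actN :: "('p \<Rightarrow> 'k) \<Rightarrow> 'n::ab_group_add \<Rightarrow> 'n"
    and src tgt :: "'p \<Rightarrow> 'v" and vtx :: "'v \<Rightarrow> 'p"
  defines "ev \<equiv> (\<lambda>V. indicator (vtx ` V)) :: 'v set \<Rightarrow> 'p \<Rightarrow> 'k"
  assumes vtx: "inj vtx" "\<And>p. p \<in> H \<Longrightarrow> vtx (src p) \<in> H"
    and fin: "\<And>v w. vtx v \<in> H \<Longrightarrow> vtx w \<in> H \<Longrightarrow> finite {p \<in> H. src p = v \<and> tgt p = w}"
    and L: "\<And>\<phi> \<psi> l. actL (\<lambda>p. \<phi> p + \<psi> p) l = actL \<phi> l + actL \<psi> l" "\<And>l. actL (ev UNIV) l = l"
    and M: "\<And>\<phi> \<psi> m. actM (\<lambda>p. \<phi> p + \<psi> p) m = actM \<phi> m + actM \<psi> m" "\<And>m. actM (ev UNIV) m = m"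
      "\<And>\<phi> m n. actM \<phi> (m + n) = actM \<phi> m + actM \<phi> n"
    and cong: "\<And>\<phi> \<psi> m. (\<And>p. p \<in> H \<Longrightarrow> \<phi> p = \<psi> p) \<Longrightarrow> actM \<phi> m = actM \<psi> m"
    and src: "\<And>V \<phi> m. actM (ev V) (actM \<phi> m) = actM (\<lambda>p. if src p \<in> V then \<phi> p else 0) m"
    and tgt: "\<And>V \<phi> m. actM \<phi> (actM (ev V) m) = actM (\<lambda>p. if tgt p \<in> V then \<phi> p else 0) m"
    and i: "i 0 = 0" "\<And>\<phi> x. i (actL \<phi> x) = actM \<phi> (i x)"
    and \<pi>: "\<And>\<phi> x. \<pi> (actM \<phi> x) = actN \<phi> (\<pi> x)" "\<And>x. \<pi> x = 0 \<Longrightarrow> x \<in> range i"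
    and annL: "\<And>l. cofin_ann H actL l" and annN: "\<And>n. cofin_ann H actN n"
  shows "cofin_ann H actM m"
proof -
  \<comment> \<open>Complementary vertex sets split the unit into two parts; injectivity of
    \<open>vtx\<close> keeps their supports disjoint.\<close>
  have split: "ev UNIV = (\<lambda>p. ev V p + ev (- V) p)" for V
    using vtx(1) by (auto simp: ev_def indicator_def fun_eq_iff inj_def)
  have finV: "finite {v. vtx v \<in> F}" if "finite F" for F
    using finite_vimageI[OF that vtx(1)] by (simp add: vimage_def)
  obtain F where F: "finite F" "F \<subseteq> H" "\<And>\<phi>. \<forall>p\<in>F. \<phi> p = 0 \<Longrightarrow> actN \<phi> (\<pi> m) = 0"
    using annN[of "\<pi> m"] unfolding cofin_ann_def by blast
  have in_L: "\<exists>l. actM \<phi> m = i l" if "\<forall>p\<in>F. \<phi> p = 0" for \<phi>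
    using F(3)[OF that] \<pi> by (metis imageE)
  define W where "W = {w. vtx w \<in> F}"
  have "finite W" unfolding W_def by (rule finV) fact
  \<comment> \<open>W contains every v with \<open>vtx v\<close> in F, so no path of F lies in the
    support of \<open>ev (- W)\<close>.\<close>
  have "\<forall>p\<in>F. ev (- W) p = 0" by (auto simp: ev_def indicator_def W_def)
  then obtain l1 where l1: "actM (ev (- W)) m = i l1" using in_L by blast
  obtain F1 where F1: "finite F1" "F1 \<subseteq> H" "\<And>\<phi>. \<forall>p\<in>F1. \<phi> p = 0 \<Longrightarrow> actL \<phi> l1 = 0"
    using annL[of l1] unfolding cofin_ann_def by blast
  \<comment> \<open>The clause \<open>p \<notin> F\<close> makes an admissible function vanish on F,
    so that \<open>in_L\<close> will apply to whatever is glued from such functions.\<close>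
  define ok where "ok v \<phi> \<longleftrightarrow> (\<forall>p. \<phi> p \<noteq> 0 \<longrightarrow> src p = v \<and> tgt p \<in> W \<and> p \<notin> F)" for v and \<phi> :: "'p \<Rightarrow> 'k"
  define V where "V = {v. \<exists>\<phi>. ok v \<phi> \<and> actM \<phi> m \<noteq> 0}"
  have "finite V"
  proof -
    have "\<forall>v\<in>V. \<exists>\<phi>. ok v \<phi> \<and> actM \<phi> m \<noteq> 0" by (simp add: V_def)
    then obtain h where h: "\<And>v. v \<in> V \<Longrightarrow> ok v (h v)" "\<And>v. v \<in> V \<Longrightarrow> actM (h v) m \<noteq> 0"
      using bchoice[of V "\<lambda>v \<phi>. ok v \<phi> \<and> actM \<phi> m \<noteq> 0"] by blast
    \<comment> \<open>V is not yet known to be finite. Functions on paths may have any support, so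
      the chosen \<open>h v\<close>, whose supports have different sources, still combine into one
      function.\<close>
    define \<phi> where "\<phi> p = (if src p \<in> V then h (src p) p else 0)" for p
    have "\<forall>p\<in>F. \<phi> p = 0" using h(1) unfolding \<phi>_def ok_def by fastforce
    then obtain l where l: "actM \<phi> m = i l" using in_L by blast
    obtain E where E: "finite E" "\<And>\<phi>. \<forall>p\<in>E. \<phi> p = 0 \<Longrightarrow> actL \<phi> l = 0"
      using annL[of l] unfolding cofin_ann_def by blast
    have "V \<subseteq> {v. vtx v \<in> E}"
    proof (rule subsetI, rule ccontr)
      fix v assume v: "v \<in> V" "v \<notin> {v. vtx v \<in> E}"
      \<comment> \<open>Cutting the glued function down to source v recovers \<open>h v\<close>, so
        \<open>h v\<close> acts on m as \<open>ev {v}\<close> acts on l.\<close>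
      have "(\<lambda>p. if src p \<in> {v} then \<phi> p else 0) = h v"
        using h(1)[OF v(1)] v(1) unfolding \<phi>_def ok_def by fastforce
      hence "actM (h v) m = i (actL (ev {v}) l)" using src[of "{v}" \<phi> m] l i(2)[of _ l] by simp
      also have "actL (ev {v}) l = 0" using v(2) by (intro E) (auto simp: ev_def indicator_def)
      finally show False using h(2)[OF v(1)] i(1) by simp
    qed
    thus ?thesis using finV[OF E(1)] finite_subset by blast
  qed
  \<comment> \<open>The restriction \<open>vtx v \<in> H\<close> makes \<open>fin\<close> applicable
    and loses no path, since the source of a path in H is a vertex in H.\<close>
  define F' where "F' = F \<union> F1 \<union> (\<Union>v\<in>{v\<in>V. vtx v \<in> H}. \<Union>w\<in>W. {p \<in> H. src p = v \<and> tgt p = w})"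
  have "finite F'"
    unfolding F'_def using F(1,2) F1(1) \<open>finite V\<close> \<open>finite W\<close> by (auto simp: W_def intro!: fin)
  moreover have "F' \<subseteq> H" using F(2) F1(2) by (auto simp: F'_def)
  moreover have "actM \<phi> m = 0" if \<phi>: "\<forall>p\<in>F'. \<phi> p = 0" for \<phi>
  proof -
    \<comment> \<open>This is \<phi> multiplied by the idempotent of W. It acts on m as \<phi> does,
      because F1 disposes of the complementary part of m.\<close>
    define g where "g = (\<lambda>p. if tgt p \<in> W then \<phi> p else 0)"
    have M0: "actM (\<lambda>_. 0) x = 0" for x using M(1)[of "\<lambda>_. 0" "\<lambda>_. 0" x] by simp
    have "m = actM (ev W) m + actM (ev (- W)) m"
      using M(1)[of "ev W" "ev (- W)" m] M(2)[of m] split[of W] by simp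
    hence "actM \<phi> m = actM \<phi> (actM (ev W) m) + actM \<phi> (i l1)"
      using M(3)[of \<phi> "actM (ev W) m" "i l1"] l1 by simp
    also have "actM \<phi> (i l1) = 0"
      using F1(3)[of \<phi>] \<phi> i(1) i(2)[of \<phi> l1] by (simp add: F'_def)
    finally have g: "actM \<phi> m = actM g m" by (simp add: tgt g_def)
    have gF: "\<forall>p\<in>F. g p = 0" using \<phi> by (simp add: F'_def g_def)
    then obtain l where l: "actM g m = i l" using in_L by blast
    obtain E where E: "finite E" "\<And>\<phi>. \<forall>p\<in>E. \<phi> p = 0 \<Longrightarrow> actL \<phi> l = 0"
      using annL[of l] unfolding cofin_ann_def by blast
    define X where "X = {v. vtx v \<in> E}"
    have "finite X" unfolding X_def by (rule finV) fact
    \<comment> \<open>For v in V the cut-down function is zero on H, since \<open>F'\<close>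
      contains the paths of H from v to W. For other v it is admissible and kills m by the
      definition of V.\<close>
    have single: "actM (\<lambda>p. if src p = v then g p else 0) m = 0" for v
    proof (cases "v \<in> V")
      case True
      have "(if src p = v then g p else 0) = 0" if "p \<in> H" for p
        using \<phi> that True vtx(2)[OF that] by (auto simp: g_def F'_def)
      thus ?thesis using cong[of _ "\<lambda>_. 0" m] M0 by simp
    next
      case False
      moreover have "ok v (\<lambda>p. if src p = v then g p else 0)"
        using gF unfolding ok_def g_def by auto
      ultimately show ?thesis unfolding V_def by blast
    qed
    have sum: "actM (\<lambda>p. if src p \<in> Y then g p else 0) m = 0" if "finite Y" for Y
      using that
    proof induction
      case (insert v Y)
      have "(\<lambda>p. if src p \<in> insert v Y then g p else 0) =
          (\<lambda>p. (if src p = v then g p else 0) + (if src p \<in> Y then g p else 0))"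
        using insert(2) by (auto simp: fun_eq_iff)
      thus ?case
        using M(1)[of "\<lambda>p. if src p = v then g p else 0" "\<lambda>p. if src p \<in> Y then g p else 0" m]
          insert.IH single[of v] by simp
    qed (simp add: M0)
    \<comment> \<open>Outside X the vertex idempotents kill l, so \<open>actM g m\<close> has only
      finitely many source components, and the finite sum over X is all of it.\<close>
    have "l = actL (ev X) l + actL (ev (- X)) l"
      using L(1)[of "ev X" "ev (- X)" l] L(2)[of l] split[of X] by simp
    also have "actL (ev (- X)) l = 0" by (intro E) (auto simp: ev_def indicator_def X_def)
    finally have "actM \<phi> m = actM (ev X) (actM g m)" using g l i(2)[of "ev X" l] by simp
    thus ?thesis using sum[OF \<open>finite X\<close>] src[of X g m] by simp
  qed
  ultimately show ?thesis unfolding cofin_ann_def by blast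
qed

section \<open>Coefficients of tensors\<close>

text \<open>Formal sums satisfy the tensor identities only modulo the relations, hence the set R.
  The second argument is confined to S because relations are imposed only on elements of the
  subspace.\<close>

definition bilinear_mod ::
  "('x \<Rightarrow>\<^sub>0 'k::field) set \<Rightarrow> ('k \<Rightarrow> 'm::ab_group_add \<Rightarrow> 'm) \<Rightarrow> ('p \<Rightarrow>\<^sub>0 'k) set
    \<Rightarrow> ('m \<Rightarrow> ('p \<Rightarrow>\<^sub>0 'k) \<Rightarrow> ('x \<Rightarrow>\<^sub>0 'k)) \<Rightarrow> bool" where
  "bilinear_mod R s S \<beta> \<longleftrightarrow>
     (\<forall>n n'. \<forall>c\<in>S. \<beta> (n + n') c - \<beta> n c - \<beta> n' c \<in> R) \<and>
     (\<forall>n. \<forall>c\<in>S. \<forall>c'\<in>S. \<beta> n (c + c') - \<beta> n c - \<beta> n c' \<in> R) \<and>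
     (\<forall>k n. \<forall>c\<in>S. \<beta> (s k n) c - fscale k (\<beta> n c) \<in> R) \<and>
     (\<forall>k n. \<forall>c\<in>S. \<beta> n (fscale k c) - fscale k (\<beta> n c) \<in> R)"

lemma subspace_fscale_span: "module.subspace fscale (module.span fscale (B :: ('x \<Rightarrow>\<^sub>0 'k::field) set))"
  by (rule module.subspace_span[OF vector_space_fscale[folded module_iff_vector_space]])

lemma additive_mod_sum:
  fixes R :: "('x \<Rightarrow>\<^sub>0 'k::field) set" and g :: "'a::comm_monoid_add \<Rightarrow> ('x \<Rightarrow>\<^sub>0 'k)"
  assumes R: "module.subspace fscale R"
    and A: "0 \<in> A" "\<And>a b. a \<in> A \<Longrightarrow> b \<in> A \<Longrightarrow> a + b \<in> A"
    and g: "\<And>a b. a \<in> A \<Longrightarrow> b \<in> A \<Longrightarrow> g (a + b) - g a - g b \<in> R"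
    and fin: "finite I" and x: "\<And>i. i \<in> I \<Longrightarrow> x i \<in> A"
  shows "g (\<Sum>i\<in>I. x i) - (\<Sum>i\<in>I. g (x i)) \<in> R"
proof -
  interpret vector_space "fscale :: 'k \<Rightarrow> ('x \<Rightarrow>\<^sub>0 'k) \<Rightarrow> _" by (rule vector_space_fscale)
  have "(\<Sum>i\<in>I. x i) \<in> A \<and> g (\<Sum>i\<in>I. x i) - (\<Sum>i\<in>I. g (x i)) \<in> R"
    using fin x
  proof induction
    case empty
    \<comment> \<open>The instance a = b = 0 of the hypothesis on g puts \<open>- g 0\<close> into
      R.\<close>
    show ?case using g[OF A(1) A(1)] subspace_neg[OF R, of "- g 0"] A(1) by simp
  next
    case (insert j I)
    let ?y = "\<Sum>i\<in>I. x i"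
    have IH: "?y \<in> A" "g ?y - (\<Sum>i\<in>I. g (x i)) \<in> R" and j: "x j \<in> A" using insert by auto
    have "g (x j + ?y) - (g (x j) + (\<Sum>i\<in>I. g (x i))) =
        (g (x j + ?y) - g (x j) - g ?y) + (g ?y - (\<Sum>i\<in>I. g (x i)))" by simp
    also have "\<dots> \<in> R" by (intro subspace_add[OF R] g IH j)
    finally show ?case using insert(1,2) A(2)[OF j IH(1)] by simp
  qed
  thus ?thesis by blast
qed

lemma fscale_expand:
  fixes c :: "'p \<Rightarrow>\<^sub>0 'k::field"
  assumes "finite F" "Poly_Mapping.keys c \<subseteq> F"
  shows "c = (\<Sum>p\<in>F. fscale (Poly_Mapping.lookup c p) (fbasis p))"
  using assms
  by (intro poly_mapping_eqI)
    (auto simp: lookup_sum lookup_fscale lookup_single when_def in_keys_iff if_distrib cong: if_cong)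

text \<open>Expanding c over H and moving each scalar to the module side gives a normal form of pure
  tensors: M \<otimes> C is a direct sum of copies of M indexed by H.\<close>

lemma bilinear_mod_expand:
  fixes R :: "('x \<Rightarrow>\<^sub>0 'k::field) set" and c :: "'p \<Rightarrow>\<^sub>0 'k"
  assumes R: "module.subspace fscale R"
    and \<beta>: "bilinear_mod R s (module.span fscale (fbasis ` H)) \<beta>"
    and F: "finite F" "F \<subseteq> H" "Poly_Mapping.keys c \<subseteq> F"
  shows "\<beta> n c - (\<Sum>p\<in>F. \<beta> (s (Poly_Mapping.lookup c p) n) (fbasis p)) \<in> R"
proof -
  interpret vector_space "fscale :: 'k \<Rightarrow> ('x \<Rightarrow>\<^sub>0 'k) \<Rightarrow> _" by (rule vector_space_fscale)
  interpret P: vector_space "fscale :: 'k \<Rightarrow> ('p \<Rightarrow>\<^sub>0 'k) \<Rightarrow> _" by (rule vector_space_fscale)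
  let ?S = "P.span (fbasis ` H)" and ?c = "Poly_Mapping.lookup c"
  have b: "fbasis p \<in> ?S" if "p \<in> F" for p using that F(2) by (intro P.span_base) auto
  have "\<beta> n (\<Sum>p\<in>F. fscale (?c p) (fbasis p)) - (\<Sum>p\<in>F. \<beta> n (fscale (?c p) (fbasis p))) \<in> R"
    using \<beta> b F(1) unfolding bilinear_mod_def
    by (intro additive_mod_sum[OF R, where A = ?S]) (auto intro: P.span_zero P.span_add P.span_scale)
  hence 1: "\<beta> n c - (\<Sum>p\<in>F. \<beta> n (fscale (?c p) (fbasis p))) \<in> R"
    using fscale_expand[OF F(1,3)] by simp
  have "\<beta> n (fscale (?c p) (fbasis p)) - \<beta> (s (?c p) n) (fbasis p) \<in> R" if "p \<in> F" for p
  proof -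
    have "\<beta> n (fscale (?c p) (fbasis p)) - fscale (?c p) (\<beta> n (fbasis p)) \<in> R"
      "\<beta> (s (?c p) n) (fbasis p) - fscale (?c p) (\<beta> n (fbasis p)) \<in> R"
      using \<beta> b[OF that] unfolding bilinear_mod_def by blast+
    from subspace_diff[OF R this] show ?thesis by simp
  qed
  hence "(\<Sum>p\<in>F. \<beta> n (fscale (?c p) (fbasis p)) - \<beta> (s (?c p) n) (fbasis p)) \<in> R"
    by (rule subspace_sum[OF R])
  from subspace_add[OF R 1 this] show ?thesis by (simp add: sum_subtractf)
qed

text \<open>
  \<open>R\<close> plays the role of the relations of a tensor product. Here \<open>b i\<close> is the
  symbol of the \<open>i\<close>-th basis tensor and \<open>s (\<kappa> i x) (\<nu> x)\<close> the \<open>i\<close>-th coefficient of the pure tensor \<open>x\<close>.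
\<close>

lemma formal_sum_zeroI:
  fixes R :: "('x \<Rightarrow>\<^sub>0 'k::field) set" and t :: "'x \<Rightarrow>\<^sub>0 'k"
  assumes R: "module.subspace fscale R"
    and b: "\<And>i n n'. i \<in> J \<Longrightarrow> b i (n + n') - b i n - b i n' \<in> R"
      "\<And>i k n. i \<in> J \<Longrightarrow> b i (s k n) - fscale k (b i n) \<in> R"
    and J: "finite J"
    and expand: "\<And>x. x \<in> Poly_Mapping.keys t \<Longrightarrow> fbasis x - (\<Sum>i\<in>J. b i (s (\<kappa> i x) (\<nu> x))) \<in> R"
    and coeff: "\<And>i. i \<in> J \<Longrightarrow> flin s (\<lambda>x. s (\<kappa> i x) (\<nu> x)) t = 0"
  shows "t \<in> R"
proof -
  interpret vector_space "fscale :: 'k \<Rightarrow> ('x \<Rightarrow>\<^sub>0 'k) \<Rightarrow> _" by (rule vector_space_fscale)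
  let ?K = "Poly_Mapping.keys t" and ?t = "Poly_Mapping.lookup t"
  let ?y = "\<lambda>i x. s (\<kappa> i x) (\<nu> x)"
  have 1: "(\<Sum>x\<in>?K. fscale (?t x) (fbasis x - (\<Sum>i\<in>J. b i (?y i x)))) \<in> R"
    by (intro subspace_sum[OF R] subspace_scale[OF R] expand)
  \<comment> \<open>Modulo R the sum may be drawn into \<open>b i\<close>, where it becomes the i-th
    coefficient of t and vanishes by \<open>coeff\<close>. What remains is \<open>b i 0\<close>,
    itself in R.\<close>
  have 2: "(\<Sum>x\<in>?K. fscale (?t x) (b i (?y i x))) \<in> R" if i: "i \<in> J" for i
  proof -
    let ?A = "\<Sum>x\<in>?K. b i (s (?t x) (?y i x))"
    have "b i (\<Sum>x\<in>?K. s (?t x) (?y i x)) - ?A \<in> R"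
      by (rule additive_mod_sum[OF R, where A = UNIV]) (auto simp: b(1)[OF i])
    hence "b i 0 - ?A \<in> R" using coeff[OF i] by (simp add: flin_def)
    moreover have "b i 0 \<in> R" using b(1)[OF i, of 0 0] subspace_neg[OF R, of "- b i 0"] by simp
    ultimately have "?A \<in> R" using subspace_diff[OF R, of "b i 0" "b i 0 - ?A"] by simp
    moreover have "(\<Sum>x\<in>?K. b i (s (?t x) (?y i x)) - fscale (?t x) (b i (?y i x))) \<in> R"
      by (intro subspace_sum[OF R] b(2)[OF i])
    ultimately have "?A - (\<Sum>x\<in>?K. b i (s (?t x) (?y i x)) - fscale (?t x) (b i (?y i x))) \<in> R"
      by (rule subspace_diff[OF R])
    thus ?thesis by (simp add: sum_subtractf)
  qed
  have "t = (\<Sum>x\<in>?K. fscale (?t x) (fbasis x))" by (rule fscale_expand) auto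
  also have "\<dots> = (\<Sum>x\<in>?K. fscale (?t x) (fbasis x - (\<Sum>i\<in>J. b i (?y i x)))) +
      (\<Sum>i\<in>J. \<Sum>x\<in>?K. fscale (?t x) (b i (?y i x)))"
    by (subst sum.swap) (simp add: scale_right_diff_distrib scale_sum_right sum_subtractf)
  also have "\<dots> \<in> R" by (rule subspace_add[OF R 1 subspace_sum[OF R 2]])
  finally show ?thesis .
qed

text \<open>Here \<gamma> and \<nu> read off the coalgebra and the module component of a pure
  tensor, which leaves the order of the two factors open. Only the finitely many paths occurring in
  t enter the expansion.\<close>

lemma formal_sum_zero2:
  fixes R :: "('x \<Rightarrow>\<^sub>0 'k::field) set" and t :: "'x \<Rightarrow>\<^sub>0 'k" and \<gamma> :: "'x \<Rightarrow> ('p \<Rightarrow>\<^sub>0 'k)"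
  assumes R: "module.subspace fscale R"
    and \<beta>: "bilinear_mod R s (module.span fscale (fbasis ` H)) \<beta>"
    and x: "\<And>x. x \<in> Poly_Mapping.keys t \<Longrightarrow> \<gamma> x \<in> module.span fscale (fbasis ` H) \<and> fbasis x = \<beta> (\<nu> x) (\<gamma> x)"
    and coeff: "\<And>p. p \<in> H \<Longrightarrow> flin s (\<lambda>x. s (Poly_Mapping.lookup (\<gamma> x) p) (\<nu> x)) t = 0"
  shows "t \<in> R"
proof (rule formal_sum_zeroI[OF R, where b = "\<lambda>p n. \<beta> n (fbasis p)"])
  let ?F = "\<Union>x\<in>Poly_Mapping.keys t. Poly_Mapping.keys (\<gamma> x)"
  have FH: "?F \<subseteq> H" using x by (fastforce simp: span_fbasis)
  have b: "fbasis p \<in> (module.span fscale (fbasis ` H) :: ('p \<Rightarrow>\<^sub>0 'k) set)" if "p \<in> ?F" for p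
    using that FH by (auto simp: span_fbasis)
  show "finite ?F" by auto
  show "\<beta> (n + n') (fbasis p) - \<beta> n (fbasis p) - \<beta> n' (fbasis p) \<in> R" if "p \<in> ?F" for p n n'
    using \<beta> b[OF that] by (simp add: bilinear_mod_def)
  show "\<beta> (s k n) (fbasis p) - fscale k (\<beta> n (fbasis p)) \<in> R" if "p \<in> ?F" for p k n
    using \<beta> b[OF that] by (simp add: bilinear_mod_def)
  show "fbasis y - (\<Sum>p\<in>?F. \<beta> (s (Poly_Mapping.lookup (\<gamma> y) p) (\<nu> y)) (fbasis p)) \<in> R"
    if "y \<in> Poly_Mapping.keys t" for y
    using bilinear_mod_expand[OF R \<beta> \<open>finite ?F\<close> FH] x[OF that] that by auto
  show "flin s (\<lambda>x. s (Poly_Mapping.lookup (\<gamma> x) p) (\<nu> x)) t = 0" if "p \<in> ?F" for p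
    using coeff that FH by blast
qed

lemma formal_sum_zero3:
  fixes R :: "('x \<Rightarrow>\<^sub>0 'k::field) set" and t :: "'x \<Rightarrow>\<^sub>0 'k" and \<gamma> \<delta> :: "'x \<Rightarrow> ('p \<Rightarrow>\<^sub>0 'k)"
  assumes R: "module.subspace fscale R" and s: "vector_space s"
    and \<beta>: "\<And>d. d \<in> module.span fscale (fbasis ` H) \<Longrightarrow>
        bilinear_mod R s (module.span fscale (fbasis ` H)) (\<lambda>n c. \<beta> n c d)"
      "\<And>c. c \<in> module.span fscale (fbasis ` H) \<Longrightarrow>
        bilinear_mod R s (module.span fscale (fbasis ` H)) (\<lambda>n d. \<beta> n c d)"
    and x: "\<And>x. x \<in> Poly_Mapping.keys t \<Longrightarrow> \<gamma> x \<in> module.span fscale (fbasis ` H) \<and>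
        \<delta> x \<in> module.span fscale (fbasis ` H) \<and> fbasis x = \<beta> (\<nu> x) (\<gamma> x) (\<delta> x)"
    and coeff: "\<And>p q. p \<in> H \<Longrightarrow> q \<in> H \<Longrightarrow>
        flin s (\<lambda>x. s (Poly_Mapping.lookup (\<gamma> x) p * Poly_Mapping.lookup (\<delta> x) q) (\<nu> x)) t = 0"
  shows "t \<in> R"
proof -
  interpret vector_space "fscale :: 'k \<Rightarrow> ('x \<Rightarrow>\<^sub>0 'k) \<Rightarrow> _" by (rule vector_space_fscale)
  interpret s: vector_space s by (rule s)
  let ?F = "\<Union>x\<in>Poly_Mapping.keys t. Poly_Mapping.keys (\<gamma> x) \<union> Poly_Mapping.keys (\<delta> x)"
  let ?S = "module.span fscale (fbasis ` H) :: ('p \<Rightarrow>\<^sub>0 'k) set"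
  let ?\<kappa> = "\<lambda>(p, q) x. Poly_Mapping.lookup (\<gamma> x) p * Poly_Mapping.lookup (\<delta> x) q"
  let ?b = "\<lambda>(p, q) n. \<beta> n (fbasis p) (fbasis q)"
  have FH: "?F \<subseteq> H" using x by (fastforce simp: span_fbasis)
  have b: "fbasis p \<in> ?S" if "p \<in> ?F" for p
    using that FH by (auto simp: span_fbasis)
  have finF: "finite ?F" by auto
  show ?thesis
  proof (rule formal_sum_zeroI[OF R, where b = ?b])
    show "finite (?F \<times> ?F)" using finF by (rule finite_cartesian_product[OF _ finF])
    fix i assume "i \<in> ?F \<times> ?F"
    then obtain p q where i: "i = (p, q)" "p \<in> ?F" "q \<in> ?F" by blast
    show "?b i (n + n') - ?b i n - ?b i n' \<in> R" for n n'
      using \<beta>(1)[OF b[OF i(3)]] b[OF i(2)] i(1) by (simp add: bilinear_mod_def)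
    show "?b i (s k n) - fscale k (?b i n) \<in> R" for k n
      using \<beta>(1)[OF b[OF i(3)]] b[OF i(2)] i(1) by (simp add: bilinear_mod_def)
    show "flin s (\<lambda>x. s (?\<kappa> i x) (\<nu> x)) t = 0"
      using coeff[of p q] i FH by (simp add: subset_iff)
  next
    fix y assume y: "y \<in> Poly_Mapping.keys t"
    let ?c = "Poly_Mapping.lookup (\<gamma> y)" and ?d = "Poly_Mapping.lookup (\<delta> y)"
    have keys: "Poly_Mapping.keys (\<gamma> y) \<subseteq> ?F" "Poly_Mapping.keys (\<delta> y) \<subseteq> ?F" using y by auto
    \<comment> \<open>First \<open>\<gamma> y\<close> is expanded with \<open>\<delta> y\<close>
      fixed, then \<open>\<delta> y\<close> next to each basis path; the two scalars on the module
      element multiply to the double coefficient.\<close>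
    have 1: "\<beta> (\<nu> y) (\<gamma> y) (\<delta> y) - (\<Sum>p\<in>?F. \<beta> (s (?c p) (\<nu> y)) (fbasis p) (\<delta> y)) \<in> R"
      using x[OF y] by (intro bilinear_mod_expand[OF R \<beta>(1) finF FH keys(1)]) auto
    have 2: "(\<Sum>p\<in>?F. \<beta> (s (?c p) (\<nu> y)) (fbasis p) (\<delta> y) -
        (\<Sum>q\<in>?F. \<beta> (s (?d q) (s (?c p) (\<nu> y))) (fbasis p) (fbasis q))) \<in> R"
      by (intro subspace_sum[OF R] bilinear_mod_expand[OF R \<beta>(2) finF FH keys(2)] b)
    have "fbasis y - (\<Sum>p\<in>?F. \<Sum>q\<in>?F. \<beta> (s (?c p * ?d q) (\<nu> y)) (fbasis p) (fbasis q)) \<in> R"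
      using subspace_add[OF R 1 2] x[OF y] by (simp add: sum_subtractf mult.commute)
    thus "fbasis y - (\<Sum>i\<in>?F \<times> ?F. ?b i (s (?\<kappa> i y) (\<nu> y))) \<in> R"
      by (simp add: sum.cartesian_product split_def)
  qed
qed

section \<open>Equality of tensors tested on coefficients\<close>

lemma flin_diff:
  assumes "vector_space s"
  shows "flin s g (t - u) = flin s g t - flin s g u"
proof -
  interpret Vector_Spaces.linear fscale s "flin s g" by (rule linear_flin[OF assms])
  show ?thesis by (rule diff)
qed

lemma flin_flin:
  assumes "vector_space s"
  shows "flin s g (flin fscale h t) = flin s (\<lambda>x. flin s g (h x)) t"
proof -
  interpret Vector_Spaces.linear fscale s "flin s g" by (rule linear_flin[OF assms])
  show ?thesis unfolding flin_def[of fscale] flin_def[of s "\<lambda>x. flin s g (h x)"]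
    by (simp add: sum scale)
qed

lemma flin_cong:
  "(\<And>x. x \<in> Poly_Mapping.keys t \<Longrightarrow> g x = h x) \<Longrightarrow> flin s g t = flin s h t"
  by (simp add: flin_def)

lemma keys_diff_subset:
  "Poly_Mapping.keys t \<subseteq> X \<Longrightarrow> Poly_Mapping.keys u \<subseteq> X \<Longrightarrow> Poly_Mapping.keys (t - u) \<subseteq> X"
  using keys_diff[of t u] by blast

lemma tensor_relsI:
  shows "a \<in> A \<Longrightarrow> a' \<in> A \<Longrightarrow> b \<in> B \<Longrightarrow> fbasis (a + a', b) - fbasis (a, b) - fbasis (a', b) \<in> tensor_rels sA A sB B"
    and "a \<in> A \<Longrightarrow> b \<in> B \<Longrightarrow> b' \<in> B \<Longrightarrow> fbasis (a, b + b') - fbasis (a, b) - fbasis (a, b') \<in> tensor_rels sA A sB B"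
    and "a \<in> A \<Longrightarrow> b \<in> B \<Longrightarrow> fbasis (sA k a, b) - fscale k (fbasis (a, b)) \<in> tensor_rels sA A sB B"
    and "a \<in> A \<Longrightarrow> b \<in> B \<Longrightarrow> fbasis (a, sB k b) - fscale k (fbasis (a, b)) \<in> tensor_rels sA A sB B"
  unfolding tensor_rels_def
  subgoal by (rule UnI1, rule UnI1, rule UnI1, intro CollectI exI conjI, rule refl, assumption+)
  subgoal by (rule UnI1, rule UnI1, rule UnI2, intro CollectI exI conjI, rule refl, assumption+)
  subgoal by (rule UnI1, rule UnI2, intro CollectI exI conjI, rule refl, assumption+)
  subgoal by (rule UnI2, intro CollectI exI conjI, rule refl, assumption+)
  done

lemma tensor3_relsI:
  shows "a \<in> A \<Longrightarrow> a' \<in> A \<Longrightarrow> b \<in> B \<Longrightarrow> d \<in> D \<Longrightarrow> fbasis (a + a', b, d) - fbasis (a, b, d) - fbasis (a', b, d) \<in> tensor3_rels sA A sB B sD D"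
    and "a \<in> A \<Longrightarrow> b \<in> B \<Longrightarrow> b' \<in> B \<Longrightarrow> d \<in> D \<Longrightarrow> fbasis (a, b + b', d) - fbasis (a, b, d) - fbasis (a, b', d) \<in> tensor3_rels sA A sB B sD D"
    and "a \<in> A \<Longrightarrow> b \<in> B \<Longrightarrow> d \<in> D \<Longrightarrow> d' \<in> D \<Longrightarrow> fbasis (a, b, d + d') - fbasis (a, b, d) - fbasis (a, b, d') \<in> tensor3_rels sA A sB B sD D"
    and "a \<in> A \<Longrightarrow> b \<in> B \<Longrightarrow> d \<in> D \<Longrightarrow> fbasis (sA k a, b, d) - fscale k (fbasis (a, b, d)) \<in> tensor3_rels sA A sB B sD D"
    and "a \<in> A \<Longrightarrow> b \<in> B \<Longrightarrow> d \<in> D \<Longrightarrow> fbasis (a, sB k b, d) - fscale k (fbasis (a, b, d)) \<in> tensor3_rels sA A sB B sD D"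
    and "a \<in> A \<Longrightarrow> b \<in> B \<Longrightarrow> d \<in> D \<Longrightarrow> fbasis (a, b, sD k d) - fscale k (fbasis (a, b, d)) \<in> tensor3_rels sA A sB B sD D"
  unfolding tensor3_rels_def
  subgoal by (rule UnI1, rule UnI1, rule UnI1, rule UnI1, rule UnI1, intro CollectI exI conjI, rule refl, assumption+)
  subgoal by (rule UnI1, rule UnI1, rule UnI1, rule UnI1, rule UnI2, intro CollectI exI conjI, rule refl, assumption+)
  subgoal by (rule UnI1, rule UnI1, rule UnI1, rule UnI2, intro CollectI exI conjI, rule refl, assumption+)
  subgoal by (rule UnI1, rule UnI1, rule UnI2, intro CollectI exI conjI, rule refl, assumption+)
  subgoal by (rule UnI1, rule UnI2, intro CollectI exI conjI, rule refl, assumption+)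
  subgoal by (rule UnI2, intro CollectI exI conjI, rule refl, assumption+)
  done

text \<open>Since H is a basis of C, the coefficients at the paths of H determine an element of M
  \<otimes> C. This turns comodule axioms, which are equations between tensors, into equations in
  M.\<close>

lemma tensor_eqI_right:
  fixes s :: "'k::field \<Rightarrow> 'm::ab_group_add \<Rightarrow> 'm" and t u :: "'m \<times> ('p \<Rightarrow>\<^sub>0 'k) \<Rightarrow>\<^sub>0 'k"
  assumes s: "vector_space s"
    and S: "S = module.span fscale (fbasis ` H)"
    and keys: "Poly_Mapping.keys t \<subseteq> UNIV \<times> S" "Poly_Mapping.keys u \<subseteq> UNIV \<times> S"
    and eq: "\<And>p. p \<in> H \<Longrightarrow> flin s (\<lambda>(n, c). s (Poly_Mapping.lookup c p) n) t =
        flin s (\<lambda>(n, c). s (Poly_Mapping.lookup c p) n) u"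
  shows "tensor_eq s UNIV fscale S t u"
  unfolding tensor_eq_def
proof (rule formal_sum_zero2[OF subspace_fscale_span, where \<beta> = "\<lambda>n c. fbasis (n, c)"
      and H = H and \<gamma> = snd and \<nu> = fst])
  interpret X: vector_space "fscale :: 'k \<Rightarrow> ('m \<times> ('p \<Rightarrow>\<^sub>0 'k) \<Rightarrow>\<^sub>0 'k) \<Rightarrow> _" by (rule vector_space_fscale)
  show "bilinear_mod (X.span (tensor_rels s UNIV fscale S)) s
      (module.span fscale (fbasis ` H)) (\<lambda>n c. fbasis (n, c))"
    unfolding S[symmetric] bilinear_mod_def
    by (intro conjI allI ballI X.span_base tensor_relsI UNIV_I)
qed (use keys_diff_subset[OF keys] eq in \<open>auto simp: S split_def flin_diff[OF s]\<close>)

lemma tensor_eqI_left: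
  fixes s :: "'k::field \<Rightarrow> 'm::ab_group_add \<Rightarrow> 'm" and t u :: "('p \<Rightarrow>\<^sub>0 'k) \<times> 'm \<Rightarrow>\<^sub>0 'k"
  assumes s: "vector_space s"
    and S: "S = module.span fscale (fbasis ` H)"
    and keys: "Poly_Mapping.keys t \<subseteq> S \<times> UNIV" "Poly_Mapping.keys u \<subseteq> S \<times> UNIV"
    and eq: "\<And>p. p \<in> H \<Longrightarrow> flin s (\<lambda>(c, n). s (Poly_Mapping.lookup c p) n) t =
        flin s (\<lambda>(c, n). s (Poly_Mapping.lookup c p) n) u"
  shows "tensor_eq fscale S s UNIV t u"
  unfolding tensor_eq_def
proof (rule formal_sum_zero2[OF subspace_fscale_span, where \<beta> = "\<lambda>n c. fbasis (c, n)"
      and H = H and \<gamma> = fst and \<nu> = snd])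
  interpret X: vector_space "fscale :: 'k \<Rightarrow> (('p \<Rightarrow>\<^sub>0 'k) \<times> 'm \<Rightarrow>\<^sub>0 'k) \<Rightarrow> _" by (rule vector_space_fscale)
  show "bilinear_mod (X.span (tensor_rels fscale S s UNIV)) s
      (module.span fscale (fbasis ` H)) (\<lambda>n c. fbasis (c, n))"
    unfolding S[symmetric] bilinear_mod_def
    by (intro conjI allI ballI X.span_base tensor_relsI UNIV_I)
qed (use keys_diff_subset[OF keys] eq in \<open>auto simp: S split_def flin_diff[OF s]\<close>)

text \<open>The form needed for coassociativity, with coefficients indexed by pairs of
  paths.\<close>

lemma tensor3_eqI_right:
  fixes s :: "'k::field \<Rightarrow> 'm::ab_group_add \<Rightarrow> 'm"
    and t u :: "'m \<times> ('p \<Rightarrow>\<^sub>0 'k) \<times> ('p \<Rightarrow>\<^sub>0 'k) \<Rightarrow>\<^sub>0 'k"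
  assumes s: "vector_space s"
    and S: "S = module.span fscale (fbasis ` H)"
    and keys: "Poly_Mapping.keys t \<subseteq> UNIV \<times> S \<times> S" "Poly_Mapping.keys u \<subseteq> UNIV \<times> S \<times> S"
    and eq: "\<And>p q. p \<in> H \<Longrightarrow> q \<in> H \<Longrightarrow>
        flin s (\<lambda>(n, c, d). s (Poly_Mapping.lookup c p * Poly_Mapping.lookup d q) n) t =
        flin s (\<lambda>(n, c, d). s (Poly_Mapping.lookup c p * Poly_Mapping.lookup d q) n) u"
  shows "tensor3_eq s UNIV fscale S fscale S t u"
  unfolding tensor3_eq_def
proof (rule formal_sum_zero3[OF subspace_fscale_span s, where \<beta> = "\<lambda>n c d. fbasis (n, c, d)"
      and H = H and \<gamma> = "\<lambda>x. fst (snd x)" and \<delta> = "\<lambda>x. snd (snd x)" and \<nu> = fst])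
  interpret X: vector_space "fscale :: 'k \<Rightarrow> ('m \<times> ('p \<Rightarrow>\<^sub>0 'k) \<times> ('p \<Rightarrow>\<^sub>0 'k) \<Rightarrow>\<^sub>0 'k) \<Rightarrow> _"
    by (rule vector_space_fscale)
  let ?R = "X.span (tensor3_rels s UNIV fscale S fscale S)"
  show "bilinear_mod ?R s (module.span fscale (fbasis ` H)) (\<lambda>n c. fbasis (n, c, d))"
    if "d \<in> module.span fscale (fbasis ` H)" for d
    using that unfolding S[symmetric] bilinear_mod_def
    by (intro conjI allI ballI X.span_base tensor3_relsI UNIV_I)
  show "bilinear_mod ?R s (module.span fscale (fbasis ` H)) (\<lambda>n d. fbasis (n, c, d))"
    if "c \<in> module.span fscale (fbasis ` H)" for c
    using that unfolding S[symmetric] bilinear_mod_def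
    by (intro conjI allI ballI X.span_base tensor3_relsI UNIV_I)
qed (use keys_diff_subset[OF keys] eq in \<open>auto simp: S split_def flin_diff[OF s]\<close>)

lemma tensor3_eqI_left:
  fixes s :: "'k::field \<Rightarrow> 'm::ab_group_add \<Rightarrow> 'm"
    and t u :: "('p \<Rightarrow>\<^sub>0 'k) \<times> ('p \<Rightarrow>\<^sub>0 'k) \<times> 'm \<Rightarrow>\<^sub>0 'k"
  assumes s: "vector_space s"
    and S: "S = module.span fscale (fbasis ` H)"
    and keys: "Poly_Mapping.keys t \<subseteq> S \<times> S \<times> UNIV" "Poly_Mapping.keys u \<subseteq> S \<times> S \<times> UNIV"
    and eq: "\<And>p q. p \<in> H \<Longrightarrow> q \<in> H \<Longrightarrow>
        flin s (\<lambda>(c, d, n). s (Poly_Mapping.lookup c p * Poly_Mapping.lookup d q) n) t =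
        flin s (\<lambda>(c, d, n). s (Poly_Mapping.lookup c p * Poly_Mapping.lookup d q) n) u"
  shows "tensor3_eq fscale S fscale S s UNIV t u"
  unfolding tensor3_eq_def
proof (rule formal_sum_zero3[OF subspace_fscale_span s, where \<beta> = "\<lambda>n c d. fbasis (c, d, n)"
      and H = H and \<gamma> = fst and \<delta> = "\<lambda>x. fst (snd x)" and \<nu> = "\<lambda>x. snd (snd x)"])
  interpret X: vector_space "fscale :: 'k \<Rightarrow> (('p \<Rightarrow>\<^sub>0 'k) \<times> ('p \<Rightarrow>\<^sub>0 'k) \<times> 'm \<Rightarrow>\<^sub>0 'k) \<Rightarrow> _"
    by (rule vector_space_fscale)
  let ?R = "X.span (tensor3_rels fscale S fscale S s UNIV)"
  show "bilinear_mod ?R s (module.span fscale (fbasis ` H)) (\<lambda>n c. fbasis (c, d, n))"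
    if "d \<in> module.span fscale (fbasis ` H)" for d
    using that unfolding S[symmetric] bilinear_mod_def
    by (intro conjI allI ballI X.span_base tensor3_relsI UNIV_I)
  show "bilinear_mod ?R s (module.span fscale (fbasis ` H)) (\<lambda>n d. fbasis (c, d, n))"
    if "c \<in> module.span fscale (fbasis ` H)" for c
    using that unfolding S[symmetric] bilinear_mod_def
    by (intro conjI allI ballI X.span_base tensor3_relsI UNIV_I)
qed (use keys_diff_subset[OF keys] eq in \<open>auto simp: S split_def flin_diff[OF s]\<close>)

section \<open>Finite dimension of extensions\<close>

text \<open>The image of a basis of L together with lifts of a basis of N spans M, and a maximal
  independent subset of this finite set is a basis.\<close>

lemma finite_dim_extension:
  assumes ex: "short_exact sL sM sN i \<pi>" and fin: "finite_dim sL" "finite_dim sN"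
  shows "finite_dim sM"
proof -
  obtain BL BN where "finite_dimensional_vector_space sL BL" "finite_dimensional_vector_space sN BN"
    using fin by (auto simp: finite_dim_def)
  then interpret L: finite_dimensional_vector_space sL BL + N: finite_dimensional_vector_space sN BN .
  interpret M: vector_space sM
    using ex by (simp add: short_exact_def Vector_Spaces.linear_def)
  interpret i: Vector_Spaces.linear sL sM i using ex by (simp add: short_exact_def)
  interpret p: Vector_Spaces.linear sM sN \<pi> using ex by (simp add: short_exact_def)
  have ex': "surj \<pi>" "range i = {m. \<pi> m = 0}" using ex by (auto simp: short_exact_def)
  let ?B = "i ` BL \<union> inv \<pi> ` BN"
  have "m \<in> M.span ?B" for m
  proof -
    have "\<pi> ` inv \<pi> ` BN = BN" using ex'(1) by (simp add: image_image surj_f_inv_f)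
    hence "\<pi> m \<in> \<pi> ` M.span (inv \<pi> ` BN)"
      using N.span_Basis p.span_image[of "inv \<pi> ` BN"] by simp
    then obtain y where y: "y \<in> M.span (inv \<pi> ` BN)" "\<pi> m = \<pi> y" by blast
    hence "m - y \<in> range i" using ex'(2) by (simp add: p.diff)
    hence "m - y \<in> M.span (i ` BL)" using L.span_Basis i.span_image[of BL] by simp
    hence "(m - y) + y \<in> M.span ?B"
      using y(1) M.span_mono[of "i ` BL" ?B] M.span_mono[of "inv \<pi> ` BN" ?B]
      by (intro M.span_add) auto
    thus ?thesis by simp
  qed
  moreover obtain B where B: "B \<subseteq> ?B" "M.independent B" "?B \<subseteq> M.span B"
    using M.maximal_independent_subset[of ?B] by blast
  ultimately have "M.span B = UNIV"
    using M.span_minimal[OF B(3) M.subspace_span] by blast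
  moreover have "finite B"
    using B(1) L.finite_Basis N.finite_Basis by (meson finite_UnI finite_imageI finite_subset)
  ultimately have "finite_dimensional_vector_space sM B" using B(2) by unfold_locales
  thus ?thesis by (auto simp: finite_dim_def)
qed

section \<open>Rational modules over monomial coalgebras\<close>

text \<open>Linear extension identifies functions on H with the dual of C. The value 0 off the span
  of H follows the convention of \<open>dual\<close> for arguments outside
  \<open>cspace\<close>.\<close>

definition functional :: "'p set \<Rightarrow> ('p \<Rightarrow> 'k::field) \<Rightarrow> ('p \<Rightarrow>\<^sub>0 'k) \<Rightarrow> 'k" where
  "functional H \<phi> c = (if Poly_Mapping.keys c \<subseteq> H then flin (*) \<phi> c else 0)"

lemma functional_add:
  "functional H (\<lambda>p. \<phi> p + \<psi> p) = (\<lambda>c. functional H \<phi> c + functional H \<psi> c)"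
  by (auto simp: functional_def flin_def fun_eq_iff algebra_simps sum.distrib)

lemma functional_scale:
  "functional H (\<lambda>p. k * \<phi> p) = (\<lambda>c. k * functional H \<phi> c)"
  by (auto simp: functional_def flin_def fun_eq_iff algebra_simps sum_distrib_left)

lemma functional_cong:
  "(\<And>p. p \<in> H \<Longrightarrow> \<phi> p = \<psi> p) \<Longrightarrow> functional H \<phi> = functional H \<psi>"
  unfolding functional_def fun_eq_iff by (auto intro!: flin_cong)

lemma functional_fbasis: "p \<in> H \<Longrightarrow> functional H \<phi> (fbasis p) = \<phi> p"
  by (simp add: functional_def flin_fbasis[OF vector_space_mult])

lemma functional_indicator_singleton:
  assumes "Poly_Mapping.keys c \<subseteq> H"
  shows "functional H (indicator {p}) c = Poly_Mapping.lookup c p"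
  using assms
  by (simp add: functional_def flin_def indicator_def in_keys_iff Int_insert_right)

lemma functional_eq_0:
  "(\<And>p. p \<in> Poly_Mapping.keys c \<Longrightarrow> \<phi> p = 0) \<Longrightarrow> functional H \<phi> c = 0"
  by (simp add: functional_def flin_def)

section \<open>Evaluation of linear extensions and of the maps f \<otimes> id and id \<otimes>
  f\<close>

lemma additive_flin:
  fixes s :: "'k::field \<Rightarrow> 'm::ab_group_add \<Rightarrow> 'm" and t :: "'x \<Rightarrow>\<^sub>0 'k"
  assumes T: "\<And>m n. T (m + n) = T m + T n" "\<And>k m. T (s k m) = s k (T m)"
  shows "T (flin s g t) = flin s (\<lambda>x. T (g x)) t"
proof -
  have T0: "T 0 = 0" using T(1)[of 0 0] by simp
  have "T (\<Sum>i\<in>I. h i) = (\<Sum>i\<in>I. T (h i))" for I and h :: "'x \<Rightarrow> 'm"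
    by (induction I rule: infinite_finite_induct) (simp_all add: T0 T(1))
  thus ?thesis by (simp add: flin_def T(2))
qed

lemma scale_flin_right:
  assumes "vector_space s"
  shows "s k (flin s g t) = flin s (\<lambda>x. s k (g x)) t"
proof -
  interpret vector_space s by fact
  show ?thesis by (rule additive_flin) (simp_all add: scale_right_distrib mult.commute)
qed

lemma scale_flin_left:
  assumes "vector_space s"
  shows "s (flin (*) h t) n = flin s (\<lambda>x. s (h x) n) t"
proof -
  interpret vector_space s by fact
  show ?thesis by (simp add: flin_def scale_sum_left)
qed

lemma flin_tensor_left:
  "vector_space s \<Longrightarrow>
    flin s g (tensor_left f t) = flin s (\<lambda>(a, e). flin s (\<lambda>(b, d). g (b, d, e)) (f a)) t"
  unfolding tensor_left_def
  by (auto simp: flin_flin flin_fbasis split_def intro!: flin_cong)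

lemma flin_tensor_right:
  "vector_space s \<Longrightarrow>
    flin s g (tensor_right f t) = flin s (\<lambda>(a, e). flin s (\<lambda>(b, d). g (a, b, d)) (f e)) t"
  unfolding tensor_right_def
  by (auto simp: flin_flin flin_fbasis split_def intro!: flin_cong)

lemma keys_tensor_left:
  assumes "Poly_Mapping.keys t \<subseteq> A \<times> E" "\<And>a. a \<in> A \<Longrightarrow> Poly_Mapping.keys (f a) \<subseteq> B \<times> D"
  shows "Poly_Mapping.keys (tensor_left f t :: _ \<Rightarrow>\<^sub>0 'k::field) \<subseteq> B \<times> D \<times> E"
proof
  fix x assume "x \<in> Poly_Mapping.keys (tensor_left f t)"
  then obtain a e where ae: "(a, e) \<in> Poly_Mapping.keys t"
    "x \<in> Poly_Mapping.keys (flin fscale (\<lambda>(b, d). fbasis (b, d, e) :: _ \<Rightarrow>\<^sub>0 'k) (f a))"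
    unfolding tensor_left_def using subsetD[OF keys_flin] by fastforce
  from subsetD[OF keys_flin ae(2)] obtain b d where "(b, d) \<in> Poly_Mapping.keys (f a)" "x = (b, d, e)"
    by (auto split: if_splits)
  thus "x \<in> B \<times> D \<times> E" using assms ae(1) by blast
qed

lemma keys_tensor_right:
  assumes "Poly_Mapping.keys t \<subseteq> A \<times> E" "\<And>e. e \<in> E \<Longrightarrow> Poly_Mapping.keys (f e) \<subseteq> B \<times> D"
  shows "Poly_Mapping.keys (tensor_right f t :: _ \<Rightarrow>\<^sub>0 'k::field) \<subseteq> A \<times> B \<times> D"
proof
  fix x assume "x \<in> Poly_Mapping.keys (tensor_right f t)"
  then obtain a e where ae: "(a, e) \<in> Poly_Mapping.keys t"
    "x \<in> Poly_Mapping.keys (flin fscale (\<lambda>(b, d). fbasis (a, b, d) :: _ \<Rightarrow>\<^sub>0 'k) (f e))"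
    unfolding tensor_right_def using subsetD[OF keys_flin] by fastforce
  from subsetD[OF keys_flin ae(2)] obtain b d where "(b, d) \<in> Poly_Mapping.keys (f e)" "x = (a, b, d)"
    by (auto split: if_splits)
  thus "x \<in> A \<times> B \<times> D" using assms ae(1) by blast
qed

section \<open>The dual algebra of a monomial coalgebra as an algebra of functions on H\<close>

locale monomial_coalg = wf_digraph Q
  for Q :: "('v, 'e) pre_digraph" +
  fixes H :: "('v, 'e) qpath set" and C :: "('k::field, ('v, 'e) qpath \<Rightarrow>\<^sub>0 'k) coalg"
  assumes paths: "H \<subseteq> quiver_paths Q" and closed: "subpath_closed Q H"
    and C: "C = monomial_coalgebra Q H"
begin

text \<open>The coordinate functional of the path p; acting by it extracts the coefficient of a
  coaction at p.\<close>

abbreviation "\<delta> p \<equiv> functional H (indicator {p})"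

lemma coalgebra_C: "coalgebra C"
  unfolding C using paths closed by (rule coalgebra_monomial_coalgebra)

lemma cspace_C: "cspace C = {c. Poly_Mapping.keys c \<subseteq> H}"
  and cspace_span: "cspace C = module.span fscale (fbasis ` H)"
  and cscale_C: "cscale C = fscale"
  and comult_C: "comult C = flin fscale (\<lambda>r. \<Sum>(p, q)\<in>factorizations Q r. fbasis (fbasis p, fbasis q))"
  and counit_C: "counit C = flin (*) (\<lambda>p. if length (snd p) = 0 then 1 else 0)"
  by (simp_all add: C monomial_coalgebra_def path_coalgebra_def span_fbasis)

lemma keys_comult: "c \<in> cspace C \<Longrightarrow> Poly_Mapping.keys (comult C c) \<subseteq> cspace C \<times> cspace C"
  using coalgebra_C unfolding coalgebra_def by blast

lemma functional_in_dual: "functional H \<phi> \<in> dual C"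
proof -
  interpret Vector_Spaces.linear fscale "(*)" "flin (*) \<phi>" by (rule linear_flin[OF vector_space_mult])
  have "Poly_Mapping.keys (c + d) \<subseteq> H" if "Poly_Mapping.keys c \<subseteq> H" "Poly_Mapping.keys d \<subseteq> H"
    for c d :: "('v, 'e) qpath \<Rightarrow>\<^sub>0 'k"
    using that keys_add[of c d] by blast
  moreover have "Poly_Mapping.keys (fscale k c) \<subseteq> H" if "Poly_Mapping.keys c \<subseteq> H"
    for k and c :: "('v, 'e) qpath \<Rightarrow>\<^sub>0 'k"
    using that keys_fscale[of k c] by blast
  ultimately show ?thesis
    by (simp add: dual_def functional_def cspace_C cscale_C add scale)
qed

lemma dual_functional:
  assumes f: "f \<in> dual C"
  shows "f = functional H (\<lambda>p. f (fbasis p))"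
proof
  fix c
  show "f c = functional H (\<lambda>p. f (fbasis p)) c"
  proof (cases "Poly_Mapping.keys c \<subseteq> H")
    case True
    interpret P: vector_space "fscale :: 'k \<Rightarrow> (('v, 'e) qpath \<Rightarrow>\<^sub>0 'k) \<Rightarrow> _" by (rule vector_space_fscale)
    let ?c = "Poly_Mapping.lookup c" and ?S = "P.span (fbasis ` H)"
    have f': "\<And>c d. c \<in> ?S \<Longrightarrow> d \<in> ?S \<Longrightarrow> f (c + d) = f c + f d"
      "\<And>k c. c \<in> ?S \<Longrightarrow> f (fscale k c) = k * f c"
      using f unfolding dual_def cspace_span cscale_C by auto
    have f0: "f 0 = 0" using f'(2)[OF P.span_zero, of 0] by (simp add: fscale_zero_left)
    \<comment> \<open>f is additive only on the span, so membership in \<open>?S\<close> has to be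
      carried through the induction.\<close>
    have "(\<Sum>p\<in>F. fscale (?c p) (fbasis p)) \<in> ?S \<and>
        f (\<Sum>p\<in>F. fscale (?c p) (fbasis p)) = (\<Sum>p\<in>F. ?c p * f (fbasis p))"
      if "finite F" "F \<subseteq> H" for F
      using that
    proof induction
      case (insert p F)
      have "fbasis p \<in> ?S" using insert by (intro P.span_base) auto
      thus ?case using insert by (simp add: f' P.span_add P.span_scale)
    qed (simp add: P.span_zero f0)
    from this[of "Poly_Mapping.keys c"] fscale_expand[of "Poly_Mapping.keys c" c] True
    show ?thesis by (simp add: functional_def flin_def)
  next
    case False
    thus ?thesis using f by (simp add: functional_def dual_def cspace_C)
  qed
qed

text \<open>With the whole range of vertices the unit takes the shape \<open>ev UNIV\<close> of
  \<open>cofin_ann_extension\<close>.\<close>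

lemma dual_unit_C: "dual_unit C = functional H (indicator (range (\<lambda>v. (v, []))))"
  by (auto simp: fun_eq_iff dual_unit_def functional_def cspace_C counit_C indicator_def intro!: flin_cong)

text \<open>Closure under subpaths puts both factors of r in H, where \<open>functional\<close>
  takes the values of \<phi> and \<psi>. Elements of the dual thus multiply like infinite series of
  paths, with paths outside H set to zero.\<close>

lemma conv_functional:
  "conv C (functional H \<phi>) (functional H \<psi>) =
    functional H (\<lambda>r. \<Sum>(p, q)\<in>factorizations Q r. \<phi> p * \<psi> q)"
proof
  fix c
  let ?g = "\<lambda>(a, b). functional H \<phi> a * functional H \<psi> b"
  have "flin (*) ?g (\<Sum>(p, q)\<in>factorizations Q r. fbasis (fbasis p, fbasis q)) =
      (\<Sum>(p, q)\<in>factorizations Q r. \<phi> p * \<psi> q)" if "r \<in> H" for r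
    unfolding flin_sum[OF vector_space_mult]
    using subpath_closed_factorizations[OF closed that]
    by (intro sum.cong refl) (auto simp: flin_fbasis[OF vector_space_mult] functional_fbasis)
  thus "conv C (functional H \<phi>) (functional H \<psi>) c =
      functional H (\<lambda>r. \<Sum>(p, q)\<in>factorizations Q r. \<phi> p * \<psi> q) c"
    by (auto simp: conv_def functional_def[of H _ c] comult_C cspace_C flin_flin[OF vector_space_mult]
        intro!: flin_cong)
qed

lemma conv_in_dual:
  assumes "f \<in> dual C" "g \<in> dual C"
  shows "conv C f g \<in> dual C"
  using conv_functional functional_in_dual
  by (subst dual_functional[OF assms(1)], subst dual_functional[OF assms(2)]) simp

text \<open>The only factorization of r whose first factor is a vertex is the one into the source of
  r and r itself.\<close>

lemma conv_vertices_left: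
  "conv C (functional H (indicator ((\<lambda>v. (v, [])) ` V))) (functional H \<phi>) =
    functional H (\<lambda>r. if path_source r \<in> V then \<phi> r else 0)"
  unfolding conv_functional
proof (rule functional_cong)
  fix r assume r: "r \<in> H"
  let ?f = "\<lambda>z :: ('v, 'e) qpath \<times> ('v, 'e) qpath. indicator ((\<lambda>v. (v, [])) ` V) (fst z) * \<phi> (snd z) :: 'k"
  have "(\<Sum>z\<in>factorizations Q r. ?f z) = (\<Sum>z\<in>{((path_source r, []), r)}. ?f z)"
  proof (rule sum.mono_neutral_right[OF finite_factorizations])
    show "{((path_source r, []), r)} \<subseteq> factorizations Q r"
      using source_factorization r paths by blast
  qed (auto simp: factorizations_def path_source_def path_target_def indicator_def)
  thus "(\<Sum>(p, q)\<in>factorizations Q r. indicator ((\<lambda>v. (v, [])) ` V) p * \<phi> q) =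
      (if path_source r \<in> V then \<phi> r else 0)"
    by (auto simp: split_def indicator_def)
qed

lemma conv_vertices_right:
  "conv C (functional H \<phi>) (functional H (indicator ((\<lambda>v. (v, [])) ` V))) =
    functional H (\<lambda>r. if path_target Q r \<in> V then \<phi> r else 0)"
  unfolding conv_functional
proof (rule functional_cong)
  fix r assume r: "r \<in> H"
  let ?f = "\<lambda>z :: ('v, 'e) qpath \<times> ('v, 'e) qpath. \<phi> (fst z) * indicator ((\<lambda>v. (v, [])) ` V) (snd z) :: 'k"
  have "(\<Sum>z\<in>factorizations Q r. ?f z) = (\<Sum>z\<in>{(r, (path_target Q r, []))}. ?f z)"
  proof (rule sum.mono_neutral_right[OF finite_factorizations])
    show "{(r, (path_target Q r, []))} \<subseteq> factorizations Q r"
      using target_factorization r paths by blast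
  qed (auto simp: factorizations_def path_source_def indicator_def)
  thus "(\<Sum>(p, q)\<in>factorizations Q r. \<phi> p * indicator ((\<lambda>v. (v, [])) ` V) q) =
      (if path_target Q r \<in> V then \<phi> r else 0)"
    by (auto simp: split_def indicator_def)
qed

lemma source_in: "p \<in> H \<Longrightarrow> (path_source p, []) \<in> H"
  and target_in: "p \<in> H \<Longrightarrow> (path_target Q p, []) \<in> H"
  using subpath_closed_factorizations[OF closed] source_factorization target_factorization paths
  by blast+

section \<open>Rationality as a condition on annihilators\<close>

text \<open>Up to a function vanishing on \<open>F m\<close>, which kills m, f is a finite
  combination of coordinate functionals. The coaction will be read off from this formula; A stands
  for a left or a right action.\<close>

lemma cofin_ann_expand:
  fixes A :: "(_ \<Rightarrow> 'k) \<Rightarrow> 'm \<Rightarrow> 'm::ab_group_add"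
  assumes add: "\<And>f g m. f \<in> dual C \<Longrightarrow> g \<in> dual C \<Longrightarrow> A (\<lambda>c. f c + g c) m = A f m + A g m"
    and scale: "\<And>k f m. f \<in> dual C \<Longrightarrow> A (\<lambda>c. k * f c) m = s k (A f m)"
    and ann: "\<And>m. cofin_ann H (\<lambda>\<phi>. A (functional H \<phi>)) m"
  obtains F where "\<And>m. finite (F m)" "\<And>m. F m \<subseteq> H"
    "\<And>m f. f \<in> dual C \<Longrightarrow> A f m = (\<Sum>p\<in>F m. s (f (fbasis p)) (A (\<delta> p) m))"
proof -
  let ?A = "\<lambda>\<phi>. A (functional H \<phi>)"
  have A: "?A (\<lambda>p. \<phi> p + \<psi> p) m = ?A \<phi> m + ?A \<psi> m" "?A (\<lambda>p. k * \<phi> p) m = s k (?A \<phi> m)"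
    for \<phi> \<psi> k m
    by (simp_all add: functional_add functional_scale add scale functional_in_dual)
  have A0: "?A (\<lambda>_. 0) m = 0" for m using A(1)[of "\<lambda>_. 0" "\<lambda>_. 0" m] by simp
  obtain F where F: "\<And>m. finite (F m)" "\<And>m. F m \<subseteq> H" "\<And>m \<phi>. \<forall>p\<in>F m. \<phi> p = 0 \<Longrightarrow> ?A \<phi> m = 0"
    using ann unfolding cofin_ann_def by metis
  have "A f m = (\<Sum>p\<in>F m. s (f (fbasis p)) (A (\<delta> p) m))" if f: "f \<in> dual C" for f m
  proof -
    let ?\<phi> = "\<lambda>p. f (fbasis p)"
    have on: "?A (\<lambda>p. if p \<in> X then ?\<phi> p else 0) m = (\<Sum>p\<in>X. s (?\<phi> p) (A (\<delta> p) m))" if "finite X" for X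
      using that
    proof induction
      case (insert q X)
      have "(\<lambda>p. if p \<in> insert q X then ?\<phi> p else 0) =
          (\<lambda>p. ?\<phi> q * indicator {q} p + (if p \<in> X then ?\<phi> p else 0))"
        using insert(2) by (auto simp: fun_eq_iff indicator_def)
      thus ?case using insert A(1)[of "\<lambda>p. ?\<phi> q * indicator {q} p" "\<lambda>p. if p \<in> X then ?\<phi> p else 0"]
        A(2)[of "?\<phi> q" "indicator {q}"] by simp
    qed (simp add: A0)
    have "A f m = ?A ?\<phi> m" using dual_functional[OF f] by simp
    also have "?\<phi> = (\<lambda>p. (if p \<in> F m then ?\<phi> p else 0) + (if p \<in> F m then 0 else ?\<phi> p))" by auto
    also have "?A \<dots> m = ?A (\<lambda>p. if p \<in> F m then ?\<phi> p else 0) m + ?A (\<lambda>p. if p \<in> F m then 0 else ?\<phi> p) m"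
      by (rule A(1))
    also have "?A (\<lambda>p. if p \<in> F m then 0 else ?\<phi> p) m = 0" by (rule F(3)) simp
    finally show ?thesis using on[OF F(1)] by simp
  qed
  with F(1,2) show ?thesis by (rule that)
qed

text \<open>Only finitely many paths occur in the coalgebra components of t, and a functional
  vanishing on all of them vanishes on these components. The projections \<gamma> and \<nu> allow
  for coactions on either side.\<close>

lemma cofin_ann_coaction:
  fixes A :: "(_ \<Rightarrow> 'k) \<Rightarrow> 'm::ab_group_add" and t :: "'x \<Rightarrow>\<^sub>0 'k"
  assumes s: "vector_space s"
    and t: "\<And>f. f \<in> dual C \<Longrightarrow> A f = flin s (\<lambda>x. s (f (\<gamma> x)) (\<nu> x)) t"
    and F: "F = (\<Union>x\<in>Poly_Mapping.keys t. Poly_Mapping.keys (\<gamma> x))"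
  shows "(\<forall>p\<in>F. \<phi> p = 0) \<longrightarrow> A (functional H \<phi>) = 0"
proof
  interpret vector_space s by (rule s)
  assume "\<forall>p\<in>F. \<phi> p = 0"
  hence "functional H \<phi> (\<gamma> x) = 0" if "x \<in> Poly_Mapping.keys t" for x
    using that by (intro functional_eq_0) (auto simp: F)
  thus "A (functional H \<phi>) = 0" by (simp add: t functional_in_dual flin_def)
qed

lemma rational_left_cofin_ann:
  assumes "rational_left C s act"
  shows "cofin_ann H (\<lambda>\<phi>. act (functional H \<phi>)) m"
proof -
  obtain \<rho> where \<rho>: "right_comodule C s \<rho>"
    "\<And>f m. f \<in> dual C \<Longrightarrow> act f m = flin s (\<lambda>(n, c). s (f c) n) (\<rho> m)"
    using assms unfolding rational_left_def by blast
  let ?F = "\<Union>x\<in>Poly_Mapping.keys (\<rho> m). Poly_Mapping.keys (snd x)"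
  have s: "vector_space s" and "Poly_Mapping.keys (\<rho> m) \<subseteq> UNIV \<times> cspace C"
    using \<rho>(1) unfolding right_comodule_def by blast+
  hence "?F \<subseteq> H" by (fastforce simp: cspace_C)
  moreover have "(\<forall>p\<in>?F. \<phi> p = 0) \<longrightarrow> act (functional H \<phi>) m = 0" for \<phi>
    by (rule cofin_ann_coaction[OF s, where A = "\<lambda>f. act f m" and \<nu> = fst])
      (simp_all add: \<rho>(2) split_def)
  ultimately show ?thesis unfolding cofin_ann_def by (intro exI[of _ ?F]) auto
qed

lemma rational_right_cofin_ann:
  assumes "rational_right C s act"
  shows "cofin_ann H (\<lambda>\<phi> m. act m (functional H \<phi>)) m"
proof -
  obtain \<rho> where \<rho>: "left_comodule C s \<rho>"
    "\<And>f m. f \<in> dual C \<Longrightarrow> act m f = flin s (\<lambda>(c, n). s (f c) n) (\<rho> m)"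
    using assms unfolding rational_right_def by blast
  let ?F = "\<Union>x\<in>Poly_Mapping.keys (\<rho> m). Poly_Mapping.keys (fst x)"
  have s: "vector_space s" and "Poly_Mapping.keys (\<rho> m) \<subseteq> cspace C \<times> UNIV"
    using \<rho>(1) unfolding left_comodule_def by blast+
  hence "?F \<subseteq> H" by (fastforce simp: cspace_C)
  moreover have "(\<forall>p\<in>?F. \<phi> p = 0) \<longrightarrow> act m (functional H \<phi>) = 0" for \<phi>
    by (rule cofin_ann_coaction[OF s, where A = "\<lambda>f. act m f" and \<nu> = snd])
      (simp_all add: \<rho>(2) split_def)
  ultimately show ?thesis unfolding cofin_ann_def by (intro exI[of _ ?F]) auto
qed

lemma \<delta>_eq_lookup: "c \<in> cspace C \<Longrightarrow> \<delta> p c = Poly_Mapping.lookup c p"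
  by (simp add: functional_indicator_singleton cspace_C)

lemma conv_\<delta>:
  "c \<in> cspace C \<Longrightarrow>
    flin (*) (\<lambda>(a, b). Poly_Mapping.lookup a p * Poly_Mapping.lookup b q) (comult C c) =
    conv C (\<delta> p) (\<delta> q) c"
  unfolding conv_def using keys_comult[of c] by (auto simp: \<delta>_eq_lookup intro!: flin_cong)

text \<open>The coaction sends m to the finite sum of the tensors \<open>act (\<delta> p) m\<close>
  \<otimes> p. Its coefficients are values of the action, so each comodule axiom turns into a law of
  the module.\<close>

lemma rational_leftI:
  fixes s :: "'k \<Rightarrow> 'm::ab_group_add \<Rightarrow> 'm"
  assumes act: "left_dual_module C s act" and ann: "\<And>m. cofin_ann H (\<lambda>\<phi>. act (functional H \<phi>)) m"
  shows "rational_left C s act"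
proof -
  have s: "vector_space s" using act by (simp add: left_dual_module_def)
  have lin: "act f (m + n) = act f m + act f n" "act f (s k m) = s k (act f m)"
    if "f \<in> dual C" for f k m n
    using act that by (simp_all add: left_dual_module_def)
  have conv: "act (conv C f g) m = act f (act g m)" if "f \<in> dual C" "g \<in> dual C" for f g m
    using act that by (simp add: left_dual_module_def)
  have unit: "act (dual_unit C) m = m" for m using act by (simp add: left_dual_module_def)
  obtain F where F: "\<And>m. finite (F m)" "\<And>m. F m \<subseteq> H"
    "\<And>m f. f \<in> dual C \<Longrightarrow> act f m = (\<Sum>p\<in>F m. s (f (fbasis p)) (act (\<delta> p) m))"
    by (rule cofin_ann_expand[where A = act and s = s])
      (use act ann in \<open>auto simp: left_dual_module_def\<close>)
  define \<rho> :: "'m \<Rightarrow> ('m \<times> (('v, 'e) qpath \<Rightarrow>\<^sub>0 'k) \<Rightarrow>\<^sub>0 'k)"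
    where "\<rho> m = (\<Sum>p\<in>F m. fbasis (act (\<delta> p) m, fbasis p))" for m
  have act_\<rho>: "flin s (\<lambda>(n, c). s (f c) n) (\<rho> m) = act f m" if "f \<in> dual C" for f m
    unfolding \<rho>_def flin_sum[OF s] flin_fbasis[OF s] by (simp add: F(3)[OF that])
  have keys: "Poly_Mapping.keys (\<rho> m) \<subseteq> UNIV \<times> cspace C" for m
    unfolding \<rho>_def using F(2)[of m] by (intro order_trans[OF keys_sum]) (auto simp: cspace_C)
  \<comment> \<open>The choice of \<open>F m\<close> no longer shows in the coefficients; this is
    why \<rho> respects sums and scalars in the tensor product although F need not vary compatibly
    with m.\<close>
  have coeff: "flin s (\<lambda>(n, c). s (Poly_Mapping.lookup c p) n) (\<rho> m) = act (\<delta> p) m" for p m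
    unfolding act_\<rho>[OF functional_in_dual, symmetric]
    using keys[of m] by (intro flin_cong) (auto simp: \<delta>_eq_lookup)
  interpret s: vector_space s by (rule s)
  have add: "flin s g (t + u) = flin s g t + flin s g u" and scale: "flin s g (fscale k t) = s k (flin s g t)"
    for g :: "'m \<times> (('v, 'e) qpath \<Rightarrow>\<^sub>0 'k) \<Rightarrow> 'm" and t u k
  proof -
    interpret Vector_Spaces.linear fscale s "flin s g" by (rule linear_flin[OF s])
    show "flin s g (t + u) = flin s g t + flin s g u" "flin s g (fscale k t) = s k (flin s g t)"
      by (rule add, rule scale)
  qed
  have coassoc: "tensor3_eq s UNIV fscale (cspace C) fscale (cspace C)
      (tensor_left \<rho> (\<rho> m)) (tensor_right (comult C) (\<rho> m))" for m
  proof (rule tensor3_eqI_right[OF s cspace_span])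
    show "Poly_Mapping.keys (tensor_left \<rho> (\<rho> m)) \<subseteq> UNIV \<times> cspace C \<times> cspace C"
      by (rule keys_tensor_left[OF keys keys])
    show "Poly_Mapping.keys (tensor_right (comult C) (\<rho> m)) \<subseteq> UNIV \<times> cspace C \<times> cspace C"
      by (rule keys_tensor_right[OF keys keys_comult])
    \<comment> \<open>Both sides have the coefficient
      \<open>act (\<delta> p) (act (\<delta> q) m)\<close> at the pair p, q: on one side the inner
      coaction is read at p and the outer one at q, on the other the comultiplication yields the
      convolution of \<open>\<delta> p\<close> and \<open>\<delta> q\<close>.\<close>
    fix p q :: "('v, 'e) qpath"
    let ?\<psi> = "\<lambda>(n, c, d). s (Poly_Mapping.lookup c p * Poly_Mapping.lookup d q) n"
    have "flin s (\<lambda>(b, d). s (Poly_Mapping.lookup d p * k) b) (\<rho> a) = act (\<delta> p) (s k a)" for k a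
    proof -
      have "flin s (\<lambda>(b, d). s (Poly_Mapping.lookup d p * k) b) (\<rho> a) =
          s k (flin s (\<lambda>(n, c). s (Poly_Mapping.lookup c p) n) (\<rho> a))"
        by (simp add: scale_flin_right[OF s] split_def mult.commute)
      thus ?thesis by (simp add: coeff lin(2) functional_in_dual)
    qed
    hence "flin s ?\<psi> (tensor_left \<rho> (\<rho> m)) =
        flin s (\<lambda>(a, e). act (\<delta> p) (s (Poly_Mapping.lookup e q) a)) (\<rho> m)"
      by (simp add: flin_tensor_left[OF s])
    also have "\<dots> = act (\<delta> p) (act (\<delta> q) m)"
      unfolding coeff[of q m, symmetric]
      by (subst additive_flin[of "act (\<delta> p)" s]) (simp_all add: lin functional_in_dual split_def)
    also have "\<dots> = flin s (\<lambda>(a, e). s (conv C (\<delta> p) (\<delta> q) e) a) (\<rho> m)"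
      by (simp add: act_\<rho> conv conv_in_dual functional_in_dual)
    also have "\<dots> = flin s ?\<psi> (tensor_right (comult C) (\<rho> m))"
      unfolding flin_tensor_right[OF s] using keys[of m]
      by (intro flin_cong) (auto simp: conv_\<delta>[symmetric] scale_flin_left[OF s] split_def)
    finally show "flin s ?\<psi> (tensor_left \<rho> (\<rho> m)) = flin s ?\<psi> (tensor_right (comult C) (\<rho> m))" .
  qed
  have counit: "flin s (\<lambda>(n, c). s (counit C c) n) (\<rho> m) = m" for m
  proof -
    \<comment> \<open>\<open>dual_unit\<close> and \<open>counit\<close> can differ only outside
      \<open>cspace C\<close>, where no coalgebra component of \<open>\<rho> m\<close> lies.\<close>
    have "flin s (\<lambda>(n, c). s (counit C c) n) (\<rho> m) = flin s (\<lambda>(n, c). s (dual_unit C c) n) (\<rho> m)"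
      using keys[of m] by (intro flin_cong) (auto simp: dual_unit_def)
    moreover have "dual_unit C \<in> dual C" by (simp add: dual_unit_C functional_in_dual)
    ultimately show ?thesis by (simp add: act_\<rho> unit)
  qed
  have "tensor_eq s UNIV fscale (cspace C) (\<rho> (m + n)) (\<rho> m + \<rho> n)" for m n
    by (rule tensor_eqI_right[OF s cspace_span])
      (use keys order_trans[OF keys_add Un_least[OF keys keys]] in
        \<open>simp_all add: add coeff lin functional_in_dual\<close>)
  moreover have "tensor_eq s UNIV fscale (cspace C) (\<rho> (s k m)) (fscale k (\<rho> m))" for k m
    by (rule tensor_eqI_right[OF s cspace_span])
      (use keys order_trans[OF keys_fscale keys] in
        \<open>simp_all add: scale coeff lin functional_in_dual\<close>)
  ultimately have "right_comodule C s \<rho>"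
    using s keys coassoc counit by (simp add: right_comodule_def cscale_C)
  thus ?thesis using act act_\<rho> unfolding rational_left_def by (intro conjI exI[of _ \<rho>]) auto
qed

text \<open>The mirror image of \<open>rational_leftI\<close>: the coaction is the sum of the
  tensors p \<otimes> \<open>act m (\<delta> p)\<close>, and the inner coaction is now read at q, so
  that the coefficient at p, q is \<open>act (act m (\<delta> p)) (\<delta> q)\<close>.\<close>

lemma rational_rightI:
  fixes s :: "'k \<Rightarrow> 'm::ab_group_add \<Rightarrow> 'm"
  assumes act: "right_dual_module C s act" and ann: "\<And>m. cofin_ann H (\<lambda>\<phi> m. act m (functional H \<phi>)) m"
  shows "rational_right C s act"
proof -
  have s: "vector_space s" using act by (simp add: right_dual_module_def)
  have lin: "act (m + n) f = act m f + act n f" "act (s k m) f = s k (act m f)"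
    if "f \<in> dual C" for f k m n
    using act that by (simp_all add: right_dual_module_def)
  have conv: "act m (conv C f g) = act (act m f) g" if "f \<in> dual C" "g \<in> dual C" for f g m
    using act that by (simp add: right_dual_module_def)
  have unit: "act m (dual_unit C) = m" for m using act by (simp add: right_dual_module_def)
  obtain F where F: "\<And>m. finite (F m)" "\<And>m. F m \<subseteq> H"
    "\<And>m f. f \<in> dual C \<Longrightarrow> act m f = (\<Sum>p\<in>F m. s (f (fbasis p)) (act m (\<delta> p)))"
    by (rule cofin_ann_expand[where A = "\<lambda>f m. act m f" and s = s])
      (use act ann in \<open>auto simp: right_dual_module_def\<close>)
  define \<rho> :: "'m \<Rightarrow> ((('v, 'e) qpath \<Rightarrow>\<^sub>0 'k) \<times> 'm \<Rightarrow>\<^sub>0 'k)"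
    where "\<rho> m = (\<Sum>p\<in>F m. fbasis (fbasis p, act m (\<delta> p)))" for m
  have act_\<rho>: "flin s (\<lambda>(c, n). s (f c) n) (\<rho> m) = act m f" if "f \<in> dual C" for f m
    unfolding \<rho>_def flin_sum[OF s] flin_fbasis[OF s] by (simp add: F(3)[OF that])
  have keys: "Poly_Mapping.keys (\<rho> m) \<subseteq> cspace C \<times> UNIV" for m
    unfolding \<rho>_def using F(2)[of m] by (intro order_trans[OF keys_sum]) (auto simp: cspace_C)
  have coeff: "flin s (\<lambda>(c, n). s (Poly_Mapping.lookup c p) n) (\<rho> m) = act m (\<delta> p)" for p m
    unfolding act_\<rho>[OF functional_in_dual, symmetric]
    using keys[of m] by (intro flin_cong) (auto simp: \<delta>_eq_lookup)
  interpret s: vector_space s by (rule s)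
  have add: "flin s g (t + u) = flin s g t + flin s g u" and scale: "flin s g (fscale k t) = s k (flin s g t)"
    for g :: "(('v, 'e) qpath \<Rightarrow>\<^sub>0 'k) \<times> 'm \<Rightarrow> 'm" and t u k
  proof -
    interpret Vector_Spaces.linear fscale s "flin s g" by (rule linear_flin[OF s])
    show "flin s g (t + u) = flin s g t + flin s g u" "flin s g (fscale k t) = s k (flin s g t)"
      by (rule add, rule scale)
  qed
  have coassoc: "tensor3_eq fscale (cspace C) fscale (cspace C) s UNIV
      (tensor_left (comult C) (\<rho> m)) (tensor_right \<rho> (\<rho> m))" for m
  proof (rule tensor3_eqI_left[OF s cspace_span])
    show "Poly_Mapping.keys (tensor_right \<rho> (\<rho> m)) \<subseteq> cspace C \<times> cspace C \<times> UNIV"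
      by (rule keys_tensor_right[OF keys keys])
    show "Poly_Mapping.keys (tensor_left (comult C) (\<rho> m)) \<subseteq> cspace C \<times> cspace C \<times> UNIV"
      by (rule keys_tensor_left[OF keys keys_comult])
    fix p q :: "('v, 'e) qpath"
    let ?\<psi> = "\<lambda>(c, d, n). s (Poly_Mapping.lookup c p * Poly_Mapping.lookup d q) n"
    have "flin s (\<lambda>(b, d). s (k * Poly_Mapping.lookup b q) d) (\<rho> e) = act (s k e) (\<delta> q)" for k e
    proof -
      have "flin s (\<lambda>(b, d). s (k * Poly_Mapping.lookup b q) d) (\<rho> e) =
          s k (flin s (\<lambda>(c, n). s (Poly_Mapping.lookup c q) n) (\<rho> e))"
        by (simp add: scale_flin_right[OF s] split_def)
      thus ?thesis by (simp add: coeff lin(2) functional_in_dual)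
    qed
    hence "flin s ?\<psi> (tensor_right \<rho> (\<rho> m)) =
        flin s (\<lambda>(a, e). act (s (Poly_Mapping.lookup a p) e) (\<delta> q)) (\<rho> m)"
      by (simp add: flin_tensor_right[OF s])
    also have "\<dots> = act (act m (\<delta> p)) (\<delta> q)"
      unfolding coeff[of p m, symmetric]
      by (subst additive_flin[of "\<lambda>m. act m (\<delta> q)" s]) (simp_all add: lin functional_in_dual split_def)
    also have "\<dots> = flin s (\<lambda>(a, e). s (conv C (\<delta> p) (\<delta> q) a) e) (\<rho> m)"
      by (simp add: act_\<rho> conv conv_in_dual functional_in_dual)
    also have "\<dots> = flin s ?\<psi> (tensor_left (comult C) (\<rho> m))"
      unfolding flin_tensor_left[OF s] using keys[of m]
      by (intro flin_cong) (auto simp: conv_\<delta>[symmetric] scale_flin_left[OF s] split_def)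
    finally show "flin s ?\<psi> (tensor_left (comult C) (\<rho> m)) = flin s ?\<psi> (tensor_right \<rho> (\<rho> m))" ..
  qed
  have counit: "flin s (\<lambda>(c, n). s (counit C c) n) (\<rho> m) = m" for m
  proof -
    have "flin s (\<lambda>(c, n). s (counit C c) n) (\<rho> m) = flin s (\<lambda>(c, n). s (dual_unit C c) n) (\<rho> m)"
      using keys[of m] by (intro flin_cong) (auto simp: dual_unit_def)
    moreover have "dual_unit C \<in> dual C" by (simp add: dual_unit_C functional_in_dual)
    ultimately show ?thesis by (simp add: act_\<rho> unit)
  qed
  have "tensor_eq fscale (cspace C) s UNIV (\<rho> (m + n)) (\<rho> m + \<rho> n)" for m n
    by (rule tensor_eqI_left[OF s cspace_span])
      (use keys order_trans[OF keys_add Un_least[OF keys keys]] in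
        \<open>simp_all add: add coeff lin functional_in_dual\<close>)
  moreover have "tensor_eq fscale (cspace C) s UNIV (\<rho> (s k m)) (fscale k (\<rho> m))" for k m
    by (rule tensor_eqI_left[OF s cspace_span])
      (use keys order_trans[OF keys_fscale keys] in
        \<open>simp_all add: scale coeff lin functional_in_dual\<close>)
  ultimately have "left_comodule C s \<rho>"
    using s keys coassoc counit by (simp add: left_comodule_def cscale_C)
  thus ?thesis using act act_\<rho> unfolding rational_right_def by (intro conjI exI[of _ \<rho>]) auto
qed

section \<open>Extensions of rational modules\<close>

text \<open>Rationality is translated into annihilators, where \<open>cofin_ann_extension\<close>
  applies: in a left module the functional acting last stands on the left of the convolution, and a
  vertex idempotent there cuts down by the source.\<close>

lemma rational_left_extension:
  fixes sL :: "'k \<Rightarrow> 'l::ab_group_add \<Rightarrow> 'l" and sM :: "'k \<Rightarrow> 'm::ab_group_add \<Rightarrow> 'm"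
    and sN :: "'k \<Rightarrow> 'n::ab_group_add \<Rightarrow> 'n"
  assumes fin: "\<And>v w. (v, []) \<in> H \<Longrightarrow> (w, []) \<in> H \<Longrightarrow>
      finite {p \<in> H. path_source p = v \<and> path_target Q p = w}"
    and ext: "left_extension C sL actL sM actM sN actN"
    and L: "rational_left C sL actL" and N: "rational_left C sN actN"
  shows "rational_left C sM actM"
proof (rule rational_leftI)
  obtain i \<pi> where mods: "left_dual_module C sL actL" "left_dual_module C sM actM"
    and ex: "short_exact sL sM sN i \<pi>"
    and i: "\<And>f x. f \<in> dual C \<Longrightarrow> i (actL f x) = actM f (i x)"
    and \<pi>: "\<And>f x. f \<in> dual C \<Longrightarrow> \<pi> (actM f x) = actN f (\<pi> x)"
    using ext unfolding left_extension_def by blast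
  show "left_dual_module C sM actM" by fact
  interpret i: Vector_Spaces.linear sL sM i using ex by (simp add: short_exact_def)
  have conv: "actM f (actM g m) = actM (conv C f g) m" if "f \<in> dual C" "g \<in> dual C" for f g m
    using mods(2) that by (simp add: left_dual_module_def)
  fix m
  show "cofin_ann H (\<lambda>\<phi>. actM (functional H \<phi>)) m"
  proof (rule cofin_ann_extension[where vtx = "\<lambda>v. (v, [])" and src = path_source
        and tgt = "path_target Q" and actL = "\<lambda>\<phi>. actL (functional H \<phi>)"
        and actN = "\<lambda>\<phi>. actN (functional H \<phi>)" and i = i and \<pi> = \<pi>])
    show "actM (functional H \<phi>) m = actM (functional H \<psi>) m" if "\<And>p. p \<in> H \<Longrightarrow> \<phi> p = \<psi> p" for \<phi> \<psi> m
      using functional_cong[of H \<phi> \<psi>] that by simp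
    show "x \<in> range i" if "\<pi> x = 0" for x using ex that by (simp add: short_exact_def)
  qed (use mods L N in \<open>simp_all add: fin source_in functional_add functional_in_dual i \<pi> conv
      conv_vertices_left conv_vertices_right left_dual_module_def inj_def rational_left_cofin_ann
      flip: dual_unit_C\<close>)
qed

text \<open>In a right module the functional acting last stands on the right of the convolution,
  where a vertex idempotent cuts down by the target; hence target and source change places.\<close>

lemma rational_right_extension:
  fixes sL :: "'k \<Rightarrow> 'l::ab_group_add \<Rightarrow> 'l" and sM :: "'k \<Rightarrow> 'm::ab_group_add \<Rightarrow> 'm"
    and sN :: "'k \<Rightarrow> 'n::ab_group_add \<Rightarrow> 'n"
  assumes fin: "\<And>v w. (v, []) \<in> H \<Longrightarrow> (w, []) \<in> H \<Longrightarrow>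
      finite {p \<in> H. path_source p = v \<and> path_target Q p = w}"
    and ext: "right_extension C sL actL sM actM sN actN"
    and L: "rational_right C sL actL" and N: "rational_right C sN actN"
  shows "rational_right C sM actM"
proof (rule rational_rightI)
  obtain i \<pi> where mods: "right_dual_module C sL actL" "right_dual_module C sM actM"
    and ex: "short_exact sL sM sN i \<pi>"
    and i: "\<And>f x. f \<in> dual C \<Longrightarrow> i (actL x f) = actM (i x) f"
    and \<pi>: "\<And>f x. f \<in> dual C \<Longrightarrow> \<pi> (actM x f) = actN (\<pi> x) f"
    using ext unfolding right_extension_def by blast
  show "right_dual_module C sM actM" by fact
  interpret i: Vector_Spaces.linear sL sM i using ex by (simp add: short_exact_def)
  have conv: "actM (actM m f) g = actM m (conv C f g)" if "f \<in> dual C" "g \<in> dual C" for f g m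
    using mods(2) that by (simp add: right_dual_module_def)
  fix m
  show "cofin_ann H (\<lambda>\<phi> m. actM m (functional H \<phi>)) m"
  proof (rule cofin_ann_extension[where vtx = "\<lambda>v. (v, [])" and src = "path_target Q"
        and tgt = path_source and actL = "\<lambda>\<phi> x. actL x (functional H \<phi>)"
        and actN = "\<lambda>\<phi> x. actN x (functional H \<phi>)" and i = i and \<pi> = \<pi>])
    show "actM m (functional H \<phi>) = actM m (functional H \<psi>)" if "\<And>p. p \<in> H \<Longrightarrow> \<phi> p = \<psi> p" for \<phi> \<psi> m
      using functional_cong[of H \<phi> \<psi>] that by simp
    show "x \<in> range i" if "\<pi> x = 0" for x using ex that by (simp add: short_exact_def)
    \<comment> \<open>The finiteness hypothesis covers both orders of the two vertices, so it
      survives the exchange.\<close>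
    show "finite {p \<in> H. path_target Q p = v \<and> path_source p = w}"
      if "(v, []) \<in> H" "(w, []) \<in> H" for v w
      using fin[OF that(2,1)] by (simp add: conj_commute)
  qed (use mods L N in \<open>simp_all add: target_in functional_add functional_in_dual i \<pi> conv
      conv_vertices_left conv_vertices_right right_dual_module_def inj_def rational_right_cofin_ann
      flip: dual_unit_C\<close>)
qed

end

theorem theorem4p4:
  fixes Q :: "('v, 'e) pre_digraph"
    and H :: "('v, 'e) qpath set"
    and C :: "('k::field, ('v, 'e) qpath \<Rightarrow>\<^sub>0 'k) coalg"
  assumes "wf_digraph Q"
    and "H \<subseteq> quiver_paths Q"
    and "subpath_closed Q H"
    and "\<And>v w. (v, []) \<in> H \<Longrightarrow> (w, []) \<in> H \<Longrightarrow>
           finite {p \<in> H. path_source p = v \<and> path_target Q p = w}"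
    and "C = monomial_coalgebra Q H"
  shows "directly_coreflexive C TYPE('l::ab_group_add) TYPE('m::ab_group_add) TYPE('n::ab_group_add) \<and>
         rational_left_closed_under_extensions C TYPE('l) TYPE('m) TYPE('n) \<and>
         rational_right_closed_under_extensions C TYPE('l) TYPE('m) TYPE('n)"
proof -
  interpret monomial_coalg Q H C
    using assms(1-3,5) by (intro monomial_coalg.intro monomial_coalg_axioms.intro)
  \<comment> \<open>Direct coreflexivity asks for the extension to be finite dimensional as well as
    rational.\<close>
  have "finite_dim sM"
    if "left_extension C sL actL sM actM sN actN" "finite_dim sL" "finite_dim sN"
    for sL :: "'k \<Rightarrow> 'l \<Rightarrow> 'l" and actL and sM :: "'k \<Rightarrow> 'm \<Rightarrow> 'm" and actM
      and sN :: "'k \<Rightarrow> 'n \<Rightarrow> 'n" and actN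
    using that finite_dim_extension unfolding left_extension_def by blast
  thus ?thesis
    unfolding directly_coreflexive_def rational_left_closed_under_extensions_def
      rational_right_closed_under_extensions_def
    using coalgebra_C rational_left_extension[OF assms(4)] rational_right_extension[OF assms(4)]
    by blast
qed

end
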